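(* Consider Algorithm 2 described in the context. For any $\varepsilon,\delta\in(0,3/4)$, Algorithm 2 provides an $(\varepsilon,\delta)$-approximation of $\mu$, i.e. its output satisfies $\Pr\bigl(\mu(1-\varepsilon)\le\hat\mu\le\mu(1+\varepsilon)\bigr)\ge1-\delta$, and the expected value of the final number of trials $N$ is $\Theta\bigl(\frac{\log(1/\delta)}{p\,\varepsilon^2}\bigr)$. Furthermore, these bounds all hold even conditioned on an arbitrary choice of the permutation $\pi$.
   Context: Let $V$ be a set of $n$ Boolean variables and $\Phi$ a DNF formula given as a set of $m$ clauses, each a non-empty set of literals with no complementary pair. A weight function $\rho:V\to[0,1]$ is given with $\rho(\neg v)=1-\rho(v)$; a random assignment sets each $v$ true independently with probability $\rho(v)$, and $\mu$ is the probability that it satisfies $\Phi$. Write $\rho(C)=\prod_{a\in C}\rho(a)$ and $\rho(\Phi)=\sum_{C\in\Phi}\rho(C)$. Consider the process: choose a clause $C_s$ with probability $\rho(C_s)/\rho(\Phi)$, make all literals of $C_s$ true, draw all other variables independently according to $\rho$, and let $L\ge1$ be the number of satisfied clauses; define $p=\mathbb E[1/L]$ (one has $\mu=p\,\rho(\Phi)$). Logarithms are natural. Algorithm 2 (input $\Phi,\rho,\varepsilon,\delta$): let $T$ be the minimum integer with $\bigl(\frac{e^{\varepsilon/(1+\varepsilon)}}{1+\varepsilon}\bigr)^T+\bigl(\frac{e^{-\varepsilon/(1-\varepsilon)}}{1-\varepsilon}\bigr)^T\le\delta$. Choose a permutation $\pi$ of the clauses (in the paper, by a randomized procedure; the result holds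 for any $\pi$). Set $Y\leftarrow0$, $N\leftarrow0$. While $Y<T$, perform a trial: select $C_s$ with probability $\rho(C_s)/\rho(\Phi)$; create a partial assignment $\nu$ assigning only the variables of $C_s$ so that $C_s$ is satisfied; draw $Q$ uniform in $(0,1]$; set $\ell\leftarrow1$; for the clauses $C\in\Phi\setminus\{C_s\}$ in the order of $\pi$, while $\ell\le1/Q$: update $\nu$ by randomly sampling (independently, according to $\rho$) the unassigned variables of $C$, and if $\nu$ satisfies $C$ set $\ell\leftarrow\ell+1$. After the loop, if $\ell\le1/Q$ set $Y\leftarrow Y+1$; set $N\leftarrow N+1$. Output $\hat p=T/N$ and $\hat\mu=\rho(\Phi)\hat p$. *)

theory Defs
  imports "HOL-Probability.Probability" "HOL-Combinatorics.Multiset_Permutations"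
begin

datatype 'v literal = Pos (var_of: 'v) | Neg (var_of: 'v)

fun sign_of :: "'v literal \<Rightarrow> bool" where
  "sign_of (Pos v) = True"
| "sign_of (Neg v) = False"

type_synonym 'v clause = "'v literal set"

definition vars :: "'v clause \<Rightarrow> 'v set" where
  "vars C = var_of ` C"

text \<open>Finiteness of the formula and of its clauses follows from finiteness of the variable set.\<close>

definition dnf_formula :: "'v set \<Rightarrow> 'v clause set \<Rightarrow> bool" where
  "dnf_formula V \<Phi> \<longleftrightarrow>
     finite V \<and> (\<forall>C\<in>\<Phi>. C \<noteq> {} \<and> vars C \<subseteq> V \<and> \<not> (\<exists>v. Pos v \<in> C \<and> Neg v \<in> C))"

fun lit_weight :: "('v \<Rightarrow> real) \<Rightarrow> 'v literal \<Rightarrow> real" where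
  "lit_weight \<rho> (Pos v) = \<rho> v"
| "lit_weight \<rho> (Neg v) = 1 - \<rho> v"

definition clause_weight :: "('v \<Rightarrow> real) \<Rightarrow> 'v clause \<Rightarrow> real" where
  "clause_weight \<rho> C = (\<Prod>a\<in>C. lit_weight \<rho> a)"

definition formula_weight :: "('v \<Rightarrow> real) \<Rightarrow> 'v clause set \<Rightarrow> real" where
  "formula_weight \<rho> \<Phi> = (\<Sum>C\<in>\<Phi>. clause_weight \<rho> C)"

text \<open>Clauses are conjunctions of literals, as the formula is in disjunctive normal form.\<close>

definition clause_true :: "('v \<Rightarrow> bool) \<Rightarrow> 'v clause \<Rightarrow> bool" where
  "clause_true \<sigma> C \<longleftrightarrow> (\<forall>a\<in>C. \<sigma> (var_of a) = sign_of a)"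

text \<open>Independent values for the variables in \<open>U\<close>; the value \<open>False\<close> outside \<open>U\<close> is a dummy.\<close>

definition draw_vars :: "('v \<Rightarrow> real) \<Rightarrow> 'v set \<Rightarrow> ('v \<Rightarrow> bool) pmf" where
  "draw_vars \<rho> U = Pi_pmf U False (\<lambda>v. bernoulli_pmf (\<rho> v))"

definition dnf_prob :: "'v set \<Rightarrow> 'v clause set \<Rightarrow> ('v \<Rightarrow> real) \<Rightarrow> real" where
  "dnf_prob V \<Phi> \<rho> = measure_pmf.prob (draw_vars \<rho> V) {\<sigma>. \<exists>C\<in>\<Phi>. clause_true \<sigma> C}"

text \<open>This is the intended distribution only if \<open>formula_weight \<rho> \<Phi> > 0\<close>.\<close>

definition select_clause :: "'v clause set \<Rightarrow> ('v \<Rightarrow> real) \<Rightarrow> 'v clause pmf" where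
  "select_clause \<Phi> \<rho> =
     embed_pmf (\<lambda>C. if C \<in> \<Phi> then clause_weight \<rho> C / formula_weight \<rho> \<Phi> else 0)"

definition force_clause :: "'v clause \<Rightarrow> ('v \<Rightarrow> bool) \<Rightarrow> 'v \<Rightarrow> bool" where
  "force_clause C \<sigma> = (\<lambda>v. if v \<in> vars C then Pos v \<in> C else \<sigma> v)"

definition num_satisfied_pmf :: "'v set \<Rightarrow> 'v clause set \<Rightarrow> ('v \<Rightarrow> real) \<Rightarrow> nat pmf" where
  "num_satisfied_pmf V \<Phi> \<rho> =
     do { C\<^sub>s \<leftarrow> select_clause \<Phi> \<rho>;
          \<sigma> \<leftarrow> draw_vars \<rho> (V - vars C\<^sub>s);
          return_pmf (card {C \<in> \<Phi>. clause_true (force_clause C\<^sub>s \<sigma>) C}) }"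

definition success_prob :: "'v set \<Rightarrow> 'v clause set \<Rightarrow> ('v \<Rightarrow> real) \<Rightarrow> real" where
  "success_prob V \<Phi> \<rho> = measure_pmf.expectation (num_satisfied_pmf V \<Phi> \<rho>) (\<lambda>L. 1 / real L)"

text \<open>
  For \<open>0 < \<epsilon> < 1\<close> both bases lie strictly between 0 and 1, so an integer exponent \<open>T \<le> 0\<close>
  makes the sum at least 2; for \<open>\<delta> < 2\<close> minimising over the natural numbers is the same as
  minimising over all integers.
\<close>

definition threshold :: "real \<Rightarrow> real \<Rightarrow> nat" where
  "threshold \<epsilon> \<delta> =
     (LEAST T. (exp (\<epsilon> / (1 + \<epsilon>)) / (1 + \<epsilon>)) ^ T + (exp (- \<epsilon> / (1 - \<epsilon>)) / (1 - \<epsilon>)) ^ T \<le> \<delta>)"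

definition partial_true :: "('v \<rightharpoonup> bool) \<Rightarrow> 'v clause \<Rightarrow> bool" where
  "partial_true \<nu> C \<longleftrightarrow> (\<forall>a\<in>C. \<nu> (var_of a) = Some (sign_of a))"

definition init_assignment :: "'v clause \<Rightarrow> ('v \<rightharpoonup> bool)" where
  "init_assignment C = (\<lambda>v. if v \<in> vars C then Some (Pos v \<in> C) else None)"

definition sample_unassigned ::
    "('v \<Rightarrow> real) \<Rightarrow> ('v \<rightharpoonup> bool) \<Rightarrow> 'v clause \<Rightarrow> ('v \<rightharpoonup> bool) pmf" where
  "sample_unassigned \<rho> \<nu> C =
     map_pmf (\<lambda>\<sigma> v. if v \<in> vars C - dom \<nu> then Some (\<sigma> v) else \<nu> v)
       (draw_vars \<rho> (vars C - dom \<nu>))"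

text \<open>The inner loop, returning the final value of the counter \<open>l\<close>.\<close>

fun scan_clauses ::
    "('v \<Rightarrow> real) \<Rightarrow> real \<Rightarrow> 'v clause list \<Rightarrow> ('v \<rightharpoonup> bool) \<Rightarrow> nat \<Rightarrow> nat pmf" where
  "scan_clauses \<rho> Q [] \<nu> l = return_pmf l"
| "scan_clauses \<rho> Q (C # Cs) \<nu> l =
     (if real l \<le> 1 / Q
      then do { \<nu>' \<leftarrow> sample_unassigned \<rho> \<nu> C;
                scan_clauses \<rho> Q Cs \<nu>' (if partial_true \<nu>' C then l + 1 else l) }
      else return_pmf l)"

text \<open>
  One trial, with result \<open>True\<close> iff it increments \<open>Y\<close>. A permutation \<open>\<pi>\<close> of the clauses is
  represented by the list of the clauses in that order.
\<close>

definition trial :: "'v clause set \<Rightarrow> ('v \<Rightarrow> real) \<Rightarrow> 'v clause list \<Rightarrow> bool measure" where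
  "trial \<Phi> \<rho> \<pi> =
     measure_pmf (select_clause \<Phi> \<rho>) \<bind> (\<lambda>C\<^sub>s.
     uniform_measure lborel {0<..1::real} \<bind> (\<lambda>Q.
     measure_pmf (map_pmf (\<lambda>l. real l \<le> 1 / Q)
       (scan_clauses \<rho> Q (filter (\<lambda>C. C \<noteq> C\<^sub>s) \<pi>) (init_assignment C\<^sub>s) 1))))"

text \<open>
  A run is the infinite sequence of results of independent trials, of which the outer loop
  consumes only the prefix up to its termination. The distribution of runs is given first for a
  fixed permutation and then for a permutation drawn from an arbitrary distribution \<open>P\<close>.
\<close>

definition runs_given :: "'v clause set \<Rightarrow> ('v \<Rightarrow> real) \<Rightarrow> 'v clause list \<Rightarrow> bool stream measure" where
  "runs_given \<Phi> \<rho> \<pi> = stream_space (trial \<Phi> \<rho> \<pi>)"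

definition runs :: "'v clause set \<Rightarrow> ('v \<Rightarrow> real) \<Rightarrow> 'v clause list pmf \<Rightarrow> bool stream measure" where
  "runs \<Phi> \<rho> P = measure_pmf P \<bind> runs_given \<Phi> \<rho>"

text \<open>The value of \<open>Y\<close> after \<open>k\<close> trials.\<close>

definition successes :: "bool stream \<Rightarrow> nat \<Rightarrow> nat" where
  "successes \<omega> k = card {i. i < k \<and> \<omega> !! i}"

text \<open>
  The final value of \<open>N\<close>: the number of trials performed by the loop \<open>while Y < T\<close>, which is
  \<open>\<infinity>\<close> if the loop does not terminate.
\<close>

definition num_trials :: "real \<Rightarrow> real \<Rightarrow> bool stream \<Rightarrow> enat" where
  "num_trials \<epsilon> \<delta> \<omega> = (INF k\<in>{k. \<not> successes \<omega> k < threshold \<epsilon> \<delta>}. enat k)"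

text \<open>The output, an estimate of the probability that the formula is satisfied;
  \<open>None\<close> if the loop does not terminate.\<close>

definition mu_estimate ::
    "'v clause set \<Rightarrow> ('v \<Rightarrow> real) \<Rightarrow> real \<Rightarrow> real \<Rightarrow> bool stream \<Rightarrow> real option" where
  "mu_estimate \<Phi> \<rho> \<epsilon> \<delta> \<omega> =
     (case num_trials \<epsilon> \<delta> \<omega> of
        enat N \<Rightarrow> Some (formula_weight \<rho> \<Phi> * (real (threshold \<epsilon> \<delta>) / real N))
      | \<infinity> \<Rightarrow> None)"

definition eps_delta_approx ::
    "'a measure \<Rightarrow> ('a \<Rightarrow> real option) \<Rightarrow> real \<Rightarrow> real \<Rightarrow> real \<Rightarrow> bool" where
  "eps_delta_approx M X m \<epsilon> \<delta> \<longleftrightarrow>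
     measure M {\<omega> \<in> space M. \<exists>x. X \<omega> = Some x \<and> m * (1 - \<epsilon>) \<le> x \<and> x \<le> m * (1 + \<epsilon>)} \<ge> 1 - \<delta>"

definition expected_trials :: "bool stream measure \<Rightarrow> real \<Rightarrow> real \<Rightarrow> ennreal" where
  "expected_trials M \<epsilon> \<delta> = (\<integral>\<^sup>+\<omega>. ennreal_of_enat (num_trials \<epsilon> \<delta> \<omega>) \<partial>M)"

end

theory Submission
  imports Defs
begin

text \<open>
  By deferring the random choices, a trial succeeds iff \<open>L \<le> 1 / Q\<close>, where \<open>L\<close> counts the clauses
  satisfied by a complete assignment; as \<open>Q\<close> is uniform, this happens with probability
  \<open>p = E[1 / L]\<close>, for every order of the clauses. So a run is a sequence of independent
  Bernoulli trials with parameter \<open>p\<close>, and \<open>\<mu> = p \<rho>(\<Phi>)\<close>. The number of successes in \<open>k\<close> trials is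
  binomial; Chernoff bounds with bases \<open>1 + \<epsilon>\<close> and \<open>1 - \<epsilon>\<close> at \<open>k \<approx> T / (p (1 \<plusminus> \<epsilon>))\<close> give the two summands
  in the definition of \<open>T\<close>. The expected number of trials is \<open>T / p\<close>, and
  \<open>T\<close> is of order \<open>ln (1 / \<delta>) / \<epsilon>\<^sup>2\<close>, because the logarithms of both bases in its definition are of
  order \<open>-\<epsilon>\<^sup>2\<close>.
\<close>

section \<open>The distribution of a trial\<close>

text \<open>Independence over disjoint sets, in nested form: \<open>B\<close> is drawn after
  \<open>A\<close>, as in a scan that draws the variables clause by clause.\<close>

lemma draw_vars_Un:
  assumes "finite A" "finite B" "A \<inter> B = {}"
  shows "draw_vars \<rho> (A \<union> B) =
    bind_pmf (draw_vars \<rho> A) (\<lambda>f. map_pmf (\<lambda>g v. if v \<in> A then f v else g v) (draw_vars \<rho> B))"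
  using assms unfolding draw_vars_def
  by (subst Pi_pmf_union)
    (simp_all add: pair_pmf_def map_bind_pmf map_pmf_def bind_assoc_pmf bind_return_pmf)

section \<open>Deferred decisions: partial and complete assignments\<close>

definition fill_in :: "('v \<rightharpoonup> bool) \<Rightarrow> ('v \<Rightarrow> bool) \<Rightarrow> 'v \<Rightarrow> bool" where
  "fill_in \<nu> \<sigma> v = (case \<nu> v of Some b \<Rightarrow> b | None \<Rightarrow> \<sigma> v)"

text \<open>Links the two processes: completing the state at the start of a trial gives the
  assignment from which \<open>num_satisfied_pmf\<close> counts.\<close>

lemma fill_in_init_assignment: "fill_in (init_assignment C) \<sigma> = force_clause C \<sigma>"
  by (auto simp: fill_in_def init_assignment_def force_clause_def)

lemma dom_init_assignment: "dom (init_assignment C) = vars C"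
  by (auto simp: init_assignment_def dom_def)

text \<open>No variable of \<open>C\<close> is left to \<sigma>, so its truth is settled already.
  Since \<sigma> is arbitrary, the branch taken by the scan can be rewritten inside the draw of the
  remaining variables.\<close>

lemma partial_true_iff_fill_in:
  assumes "vars C \<subseteq> dom \<nu>"
  shows "partial_true \<nu> C \<longleftrightarrow> clause_true (fill_in \<nu> \<sigma>) C"
  unfolding partial_true_def clause_true_def
proof (rule ball_cong[OF refl])
  fix a assume "a \<in> C"
  then have "var_of a \<in> dom \<nu>"
    using assms by (auto simp: vars_def)
  then show "\<nu> (var_of a) = Some (sign_of a) \<longleftrightarrow> fill_in \<nu> \<sigma> (var_of a) = sign_of a"
    by (auto simp: fill_in_def)
qed

text \<open>Principle of deferred decisions: once the counter exceeds \<open>1 / Q\<close> the outcome of the trial is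
  settled, so the remaining variables may as well be drawn.\<close>

lemma scan_clauses_eq_draw_all:
  assumes "finite V" "dom \<nu> \<subseteq> V" "\<And>C. C \<in> set Cs \<Longrightarrow> vars C \<subseteq> V"
  shows "map_pmf (\<lambda>j. real j \<le> 1 / Q) (scan_clauses \<rho> Q Cs \<nu> l) =
    map_pmf (\<lambda>\<sigma>. real (l + length (filter (clause_true (fill_in \<nu> \<sigma>)) Cs)) \<le> 1 / Q)
      (draw_vars \<rho> (V - dom \<nu>))"
  using assms(2,3)
proof (induction Cs arbitrary: \<nu> l)
  case Nil
  then show ?case
    by (simp add: map_pmf_const)
next
  case (Cons C Cs)
  show ?case
  proof (cases "real l \<le> 1 / Q")
    \<comment> \<open>The scan stops with counter \<open>l\<close>, and the full count is at least
      \<open>l\<close>, so both tests are constantly false.\<close>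
    case False
    then have "\<not> real (l + n) \<le> 1 / Q" for n
      by simp
    with False show ?thesis
      by (simp add: map_pmf_const del: of_nat_add)
  next
    case True
    let ?A = "vars C - dom \<nu>" and ?B = "V - (dom \<nu> \<union> vars C)"
    define ext where "ext \<tau> = (\<lambda>v. if v \<in> ?A then Some (\<tau> v) else \<nu> v)" for \<tau>
    \<comment> \<open>Undrawn variables split into those drawn now for \<open>C\<close> and those
      left for later.\<close>
    have V: "V - dom \<nu> = ?A \<union> ?B" "finite ?A" "finite ?B" "?A \<inter> ?B = {}"
      using Cons.prems(2)[of C] \<open>finite V\<close> by (auto intro: finite_subset)
    have dom: "dom (ext \<tau>) = dom \<nu> \<union> vars C" for \<tau>
      by (auto simp: ext_def dom_def)
    have fill: "fill_in \<nu> (\<lambda>v. if v \<in> ?A then \<tau> v else \<sigma> v) = fill_in (ext \<tau>) \<sigma>" for \<tau> \<sigma>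
      by (auto simp: fill_in_def ext_def fun_eq_iff split: option.splits)
    have IH: "map_pmf (\<lambda>j. real j \<le> 1 / Q) (scan_clauses \<rho> Q Cs (ext \<tau>) n) =
        map_pmf (\<lambda>\<sigma>. real (n + length (filter (clause_true (fill_in (ext \<tau>) \<sigma>)) Cs)) \<le> 1 / Q)
          (draw_vars \<rho> ?B)" for \<tau> n
      using Cons.IH[of "ext \<tau>" n] Cons.prems unfolding dom by simp
    have partial: "partial_true (ext \<tau>) C \<longleftrightarrow> clause_true (fill_in (ext \<tau>) \<sigma>) C" for \<tau> \<sigma>
      by (rule partial_true_iff_fill_in) (simp add: dom)
    have "map_pmf (\<lambda>j. real j \<le> 1 / Q) (scan_clauses \<rho> Q (C # Cs) \<nu> l) =
        bind_pmf (draw_vars \<rho> ?A) (\<lambda>\<tau>. map_pmf (\<lambda>j. real j \<le> 1 / Q)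
          (scan_clauses \<rho> Q Cs (ext \<tau>) (if partial_true (ext \<tau>) C then l + 1 else l)))"
      using True by (simp add: sample_unassigned_def map_bind_pmf bind_map_pmf ext_def)
    \<comment> \<open>The test of \<open>C\<close> does not depend on the later draw, so it moves
      under that draw and becomes one more entry of the filtered list.\<close>
    also have "\<dots> = bind_pmf (draw_vars \<rho> ?A) (\<lambda>\<tau>. map_pmf
        (\<lambda>\<sigma>. real (l + length (filter (clause_true (fill_in (ext \<tau>) \<sigma>)) (C # Cs))) \<le> 1 / Q)
          (draw_vars \<rho> ?B))"
      unfolding IH by (intro bind_pmf_cong map_pmf_cong refl) (simp add: partial[symmetric] add_ac)
    also have "\<dots> = map_pmf (\<lambda>\<sigma>. real (l + length (filter (clause_true (fill_in \<nu> \<sigma>)) (C # Cs))) \<le> 1 / Q)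
          (draw_vars \<rho> (V - dom \<nu>))"
      unfolding V(1) draw_vars_Un[OF V(2-4)] map_bind_pmf pmf.map_comp o_def fill ..
    finally show ?thesis .
  qed
qed

text \<open>The dependence on \<open>Q\<close> is through an integer, so its measurability is that of a function on a
  discrete space.\<close>

lemma scan_clauses_floor:
  "scan_clauses \<rho> Q Cs \<nu> l = scan_clauses \<rho> (1 / of_int \<lfloor>1 / Q\<rfloor>) Cs \<nu> l"
proof -
  \<comment> \<open>If the floor is 0, the double reciprocal is still 0, because
    \<open>1 / 0 = 0\<close>.\<close>
  have "real l \<le> 1 / Q \<longleftrightarrow> real l \<le> 1 / (1 / of_int \<lfloor>1 / Q\<rfloor>)" for l
    using le_floor_iff[of "int l" "1 / Q"] by simp linarith
  then show ?thesis
    by (induction Cs arbitrary: \<nu> l) (simp_all only: scan_clauses.simps)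
qed

lemma measurable_scan_outcome:
  "(\<lambda>Q. measure_pmf (map_pmf (\<lambda>l. real l \<le> 1 / Q) (scan_clauses \<rho> Q Cs \<nu> l))) \<in>
     uniform_measure lborel {0<..1::real} \<rightarrow>\<^sub>M subprob_algebra (count_space UNIV)"
proof -
  define g where "g K = measure_pmf (map_pmf (\<lambda>l. int l \<le> K) (scan_clauses \<rho> (1 / of_int K) Cs \<nu> l))" for K
  have eq: "(\<lambda>Q. measure_pmf (map_pmf (\<lambda>l. real l \<le> 1 / Q) (scan_clauses \<rho> Q Cs \<nu> l))) =
      (\<lambda>Q. g \<lfloor>1 / Q\<rfloor>)"
    unfolding g_def by (subst scan_clauses_floor) (simp add: le_floor_iff)
  have "(\<lambda>Q::real. \<lfloor>1 / Q\<rfloor>) \<in> uniform_measure lborel {0<..1::real} \<rightarrow>\<^sub>M count_space UNIV"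
    by measurable
  moreover have "g \<in> count_space UNIV \<rightarrow>\<^sub>M subprob_algebra (count_space UNIV)"
    unfolding g_def by measurable
  ultimately show ?thesis
    unfolding eq by (rule measurable_compose)
qed

section \<open>Measures of a trial and of the uniform variable Q\<close>

lemma prob_space_uniform: "prob_space (uniform_measure lborel {0<..1::real})"
  by (rule prob_space_uniform_measure) auto

text \<open>The inner bind of \<open>trial\<close>, named so that the two nested binds can be
  treated one at a time.\<close>

definition trial_given :: "('v \<Rightarrow> real) \<Rightarrow> 'v clause list \<Rightarrow> 'v clause \<Rightarrow> bool measure" where
  "trial_given \<rho> \<pi> C = uniform_measure lborel {0<..1::real} \<bind> (\<lambda>Q.
     measure_pmf (map_pmf (\<lambda>l. real l \<le> 1 / Q)
       (scan_clauses \<rho> Q (filter (\<lambda>C'. C' \<noteq> C) \<pi>) (init_assignment C) 1)))"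

lemma trial_eq: "trial \<Phi> \<rho> \<pi> = measure_pmf (select_clause \<Phi> \<rho>) \<bind> trial_given \<rho> \<pi>"
  by (simp add: trial_def trial_given_def[abs_def])

lemma prob_space_trial_given: "prob_space (trial_given \<rho> \<pi> C)"
  unfolding trial_given_def
  by (intro prob_space.prob_space_bind[OF prob_space_uniform _ measurable_scan_outcome] AE_I2)
    (rule measure_pmf.prob_space_axioms)

lemma sets_trial_given [simp]: "sets (trial_given \<rho> \<pi> C) = UNIV"
  unfolding trial_given_def
  using sets_bind_measurable[OF measurable_scan_outcome] by simp

text \<open>The source is discrete, so only membership of the values in the target space has to be
  checked.\<close>

lemma measurable_trial_given:
  "trial_given \<rho> \<pi> \<in> measure_pmf N \<rightarrow>\<^sub>M subprob_algebra (count_space UNIV)"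
  by (auto simp: measurable_def space_subprob_algebra prob_space_imp_subprob_space
      prob_space_trial_given)

lemma prob_space_trial: "prob_space (trial \<Phi> \<rho> \<pi>)"
  unfolding trial_eq
  by (intro prob_space.prob_space_bind[OF measure_pmf.prob_space_axioms _ measurable_trial_given]
      AE_I2 prob_space_trial_given)

lemma sets_trial: "sets (trial \<Phi> \<rho> \<pi>) = sets (count_space UNIV)"
  unfolding trial_eq by (rule sets_bind_measurable[OF measurable_trial_given]) simp

text \<open>The event is \<open>Q \<le> 1 / n\<close>, an initial piece of the unit interval. This
  is how the uniform \<open>Q\<close> turns the reciprocal of a count into a probability.\<close>

lemma emeasure_uniform_inverse:
  assumes "1 \<le> n"
  shows "emeasure (uniform_measure lborel {0<..1::real}) {Q. real n \<le> 1 / Q} = ennreal (1 / real n)"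
proof -
  have "{0<..1::real} \<inter> {Q. real n \<le> 1 / Q} = {0<..1 / real n}"
  proof (intro equalityI subsetI)
    fix Q assume Q: "Q \<in> {0<..1 / real n}"
    then have "Q \<le> 1 / real n" "1 / real n \<le> 1"
      using assms by auto
    then have "Q \<le> 1"
      by (rule order_trans)
    with Q assms show "Q \<in> {0<..1} \<inter> {Q. real n \<le> 1 / Q}"
      by (auto simp del: le_divide_eq_1 simp: field_simps intro: order_trans)
  qed (use assms in \<open>auto simp: field_simps\<close>)
  moreover have "{Q. real n \<le> 1 / Q} \<in> sets lborel"
    by measurable
  ultimately show ?thesis
    by (simp add: divide_ennreal_def)
qed

section \<open>Success probability given the selected clause\<close>

lemma finite_set_draw_vars: "finite U \<Longrightarrow> finite (set_pmf (draw_vars \<rho> U))"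
  unfolding draw_vars_def
  by (rule finite_subset[OF set_Pi_pmf_subset']) (auto intro!: finite_PiE_dflt)

text \<open>\<open>force_clause\<close> reads the value of a variable off its positive literal only;
  without complementary pairs this also makes the negative literals true.\<close>

lemma clause_true_force_clause:
  assumes "\<not> (\<exists>v. Pos v \<in> C \<and> Neg v \<in> C)"
  shows "clause_true (force_clause C \<sigma>) C"
  unfolding clause_true_def
proof
  fix a assume "a \<in> C"
  moreover from this have "var_of a \<in> vars C"
    by (simp add: vars_def)
  ultimately show "force_clause C \<sigma> (var_of a) = sign_of a"
    using assms by (cases a) (auto simp: force_clause_def)
qed

text \<open>After deferring the decisions only the count of satisfied clauses matters, so the order
  \<pi> disappears. Integrating over \<open>Q\<close> first, for a fixed complete assignment, leaves
  the reciprocal of that count.\<close>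

lemma emeasure_trial_given:
  assumes dnf: "dnf_formula V \<Phi>" and "C \<in> \<Phi>" and \<pi>: "\<pi> \<in> permutations_of_set \<Phi>"
  shows "emeasure (trial_given \<rho> \<pi> C) {True} =
    (\<integral>\<^sup>+\<sigma>. ennreal (1 / real (card {C' \<in> \<Phi>. clause_true (force_clause C \<sigma>) C'}))
       \<partial>measure_pmf (draw_vars \<rho> (V - vars C)))"
proof -
  let ?U = "uniform_measure lborel {0<..1::real}"
  let ?D = "draw_vars \<rho> (V - vars C)"
  define L where "L \<sigma> = card {C' \<in> \<Phi>. clause_true (force_clause C \<sigma>) C'}" for \<sigma>
  have V: "finite V" "\<And>C. C \<in> \<Phi> \<Longrightarrow> vars C \<subseteq> V"
    using dnf by (auto simp: dnf_formula_def)
  have \<pi>: "set \<pi> = \<Phi>" "distinct \<pi>"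
    using \<pi> by (auto simp: permutations_of_set_def)
  \<comment> \<open>The initial value 1 of the counter stands for \<open>C\<close> itself, which is
    true but skipped by the scan.\<close>
  have L: "L \<sigma> = 1 + length (filter (clause_true (force_clause C \<sigma>)) (filter (\<lambda>C'. C' \<noteq> C) \<pi>))" for \<sigma>
  proof -
    have "{C' \<in> \<Phi>. clause_true (force_clause C \<sigma>) C'} =
        insert C (set (filter (clause_true (force_clause C \<sigma>)) (filter (\<lambda>C'. C' \<noteq> C) \<pi>)))"
      using dnf \<open>C \<in> \<Phi>\<close> clause_true_force_clause[of C \<sigma>] by (auto simp: \<pi> dnf_formula_def)
    moreover have "distinct (filter (clause_true (force_clause C \<sigma>)) (filter (\<lambda>C'. C' \<noteq> C) \<pi>))"
      using \<pi>(2) by simp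
    ultimately show ?thesis
      by (simp add: L_def flip: distinct_card)
  qed
  have "emeasure (trial_given \<rho> \<pi> C) {True} = (\<integral>\<^sup>+Q. emeasure (measure_pmf
      (map_pmf (\<lambda>l. real l \<le> 1 / Q)
       (scan_clauses \<rho> Q (filter (\<lambda>C'. C' \<noteq> C) \<pi>) (init_assignment C) 1))) {True} \<partial>?U)"
    unfolding trial_given_def by (rule emeasure_bind[OF _ measurable_scan_outcome]) auto
  also have "\<dots> = (\<integral>\<^sup>+Q. emeasure (measure_pmf ?D) {\<sigma>. real (L \<sigma>) \<le> 1 / Q} \<partial>?U)"
    using V \<open>C \<in> \<Phi>\<close>
    by (subst scan_clauses_eq_draw_all[of V])
      (auto simp: \<pi> L dom_init_assignment fill_in_init_assignment vimage_def)
  \<comment> \<open>The draw has finite support, so exchanging the order of integration is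
    exchanging an integral with a finite sum.\<close>
  also have "\<dots> = (\<integral>\<^sup>+Q. (\<Sum>\<sigma>\<in>set_pmf ?D. indicator {Q. real (L \<sigma>) \<le> 1 / Q} Q * ennreal (pmf ?D \<sigma>)) \<partial>?U)"
  proof (rule nn_integral_cong)
    fix Q
    have "emeasure (measure_pmf ?D) {\<sigma>. real (L \<sigma>) \<le> 1 / Q} =
        (\<integral>\<^sup>+\<sigma>. indicator {\<sigma>. real (L \<sigma>) \<le> 1 / Q} \<sigma> \<partial>measure_pmf ?D)"
      by simp
    also have "\<dots> = (\<Sum>\<sigma>\<in>set_pmf ?D. indicator {\<sigma>. real (L \<sigma>) \<le> 1 / Q} \<sigma> * ennreal (pmf ?D \<sigma>))"
      using V by (intro nn_integral_measure_pmf_finite finite_set_draw_vars) auto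
    finally show "emeasure (measure_pmf ?D) {\<sigma>. real (L \<sigma>) \<le> 1 / Q} =
        (\<Sum>\<sigma>\<in>set_pmf ?D. indicator {Q. real (L \<sigma>) \<le> 1 / Q} Q * ennreal (pmf ?D \<sigma>))"
      by (simp add: indicator_def)
  qed
  also have "\<dots> = (\<Sum>\<sigma>\<in>set_pmf ?D. emeasure ?U {Q. real (L \<sigma>) \<le> 1 / Q} * ennreal (pmf ?D \<sigma>))"
    by (subst nn_integral_sum) (auto simp: nn_integral_multc)
  also have "\<dots> = (\<Sum>\<sigma>\<in>set_pmf ?D. ennreal (1 / real (L \<sigma>)) * ennreal (pmf ?D \<sigma>))"
    by (subst emeasure_uniform_inverse) (simp_all add: L)
  also have "\<dots> = (\<integral>\<^sup>+\<sigma>. ennreal (1 / real (L \<sigma>)) \<partial>measure_pmf ?D)"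
    using V by (intro nn_integral_measure_pmf_finite[symmetric] finite_set_draw_vars) auto
  finally show ?thesis
    by (simp add: L_def)
qed

lemma clause_weight_nonneg:
  assumes "\<And>v. v \<in> vars C \<Longrightarrow> 0 \<le> \<rho> v \<and> \<rho> v \<le> 1"
  shows "0 \<le> clause_weight \<rho> C"
  unfolding clause_weight_def
proof (rule prod_nonneg)
  fix a assume "a \<in> C"
  then have "var_of a \<in> vars C"
    by (simp add: vars_def)
  with assms show "0 \<le> lit_weight \<rho> a"
    by (cases a) auto
qed

lemma finite_dnf_formula:
  assumes "dnf_formula V \<Phi>"
  shows "finite \<Phi>"
proof (rule finite_subset)
  show "\<Phi> \<subseteq> Pow (Pos ` V \<union> Neg ` V)"
  proof (intro subsetI PowI)
    fix C a assume "C \<in> \<Phi>" "a \<in> C"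
    with assms have "var_of a \<in> V"
      by (auto simp: dnf_formula_def vars_def)
    then show "a \<in> Pos ` V \<union> Neg ` V"
      by (cases a) auto
  qed
qed (use assms in \<open>simp add: dnf_formula_def\<close>)

section \<open>Trials as Bernoulli variables with parameter p\<close>

context
  fixes V :: "'v set" and \<Phi> \<rho>
  assumes dnf: "dnf_formula V \<Phi>" and \<rho>: "\<forall>v\<in>V. 0 \<le> \<rho> v \<and> \<rho> v \<le> 1"
    and weight: "0 < formula_weight \<rho> \<Phi>"
begin

lemma weight_nonneg: "C \<in> \<Phi> \<Longrightarrow> 0 \<le> clause_weight \<rho> C"
  using dnf \<rho> by (intro clause_weight_nonneg) (auto simp: dnf_formula_def)

text \<open>Positive total weight makes the nonnegative quotients sum to 1, which is what
  \<open>embed_pmf\<close> requires of a mass function.\<close>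

lemma pmf_select_clause:
  "pmf (select_clause \<Phi> \<rho>) C = (if C \<in> \<Phi> then clause_weight \<rho> C / formula_weight \<rho> \<Phi> else 0)"
  unfolding select_clause_def
proof (rule pmf_embed_pmf)
  let ?f = "\<lambda>C. if C \<in> \<Phi> then clause_weight \<rho> C / formula_weight \<rho> \<Phi> else 0"
  show nonneg: "0 \<le> ?f C" for C
    using weight weight_nonneg by simp
  have "(\<integral>\<^sup>+C. ennreal (?f C) \<partial>count_space UNIV) = (\<Sum>C\<in>\<Phi>. ennreal (?f C))"
    using finite_dnf_formula[OF dnf] by (intro nn_integral_count_space') auto
  also have "\<dots> = ennreal (\<Sum>C\<in>\<Phi>. ?f C)"
    using nonneg by (rule sum_ennreal)
  also have "(\<Sum>C\<in>\<Phi>. ?f C) = 1"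
    using weight by (simp add: formula_weight_def flip: sum_divide_distrib)
  finally show "(\<integral>\<^sup>+C. ennreal (?f C) \<partial>count_space UNIV) = 1"
    by simp
qed

lemma set_select_clause: "set_pmf (select_clause \<Phi> \<rho>) \<subseteq> \<Phi>"
  by (auto simp: set_pmf_eq pmf_select_clause)

lemma num_satisfied_bounds:
  assumes "L \<in> set_pmf (num_satisfied_pmf V \<Phi> \<rho>)"
  shows "1 \<le> L" "L \<le> card \<Phi>"
proof -
  from assms obtain C \<sigma> where C: "C \<in> \<Phi>" and L: "L = card {C' \<in> \<Phi>. clause_true (force_clause C \<sigma>) C'}"
    using set_select_clause by (auto simp: num_satisfied_pmf_def)
  have "C \<in> {C' \<in> \<Phi>. clause_true (force_clause C \<sigma>) C'}"
    using C dnf clause_true_force_clause[of C \<sigma>] by (auto simp: dnf_formula_def)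
  then show "1 \<le> L"
    using finite_dnf_formula[OF dnf] by (auto simp: L card_gt_0_iff Suc_le_eq)
  show "L \<le> card \<Phi>"
    unfolding L using finite_dnf_formula[OF dnf] by (intro card_mono) auto
qed

lemma integrable_success: "integrable (measure_pmf (num_satisfied_pmf V \<Phi> \<rho>)) (\<lambda>L. 1 / real L)"
  by (rule measure_pmf.integrable_const_bound[where B = 1])
    (auto simp: AE_measure_pmf_iff dest: num_satisfied_bounds)

text \<open>The count never exceeds the number of clauses, so every outcome contributes at least
  \<open>1 / card \<Phi>\<close> to the average.\<close>

lemma success_prob_pos: "0 < success_prob V \<Phi> \<rho>"
proof -
  have "\<Phi> \<noteq> {}"
    using weight by (auto simp: formula_weight_def)
  then have "0 < 1 / real (card \<Phi>)"
    using finite_dnf_formula[OF dnf] by (simp add: card_gt_0_iff)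
  also have "\<dots> \<le> success_prob V \<Phi> \<rho>"
    unfolding success_prob_def
  proof (intro measure_pmf.integral_ge_const integrable_success, unfold AE_measure_pmf_iff, rule ballI)
    fix L assume "L \<in> set_pmf (num_satisfied_pmf V \<Phi> \<rho>)"
    from num_satisfied_bounds[OF this] show "1 / real (card \<Phi>) \<le> 1 / real L"
      by (intro divide_left_mono) auto
  qed
  finally show ?thesis .
qed

lemma success_prob_le_1: "success_prob V \<Phi> \<rho> \<le> 1"
  unfolding success_prob_def
  by (intro measure_pmf.integral_le_const integrable_success)
    (auto simp: AE_measure_pmf_iff dest!: num_satisfied_bounds(1))

text \<open>With the clause in the outer integral, the integrand matches
  \<open>emeasure_trial_given\<close> clause by clause.\<close>

lemma ennreal_success_prob:
  "ennreal (success_prob V \<Phi> \<rho>) = (\<integral>\<^sup>+C. (\<integral>\<^sup>+\<sigma>.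
     ennreal (1 / real (card {C' \<in> \<Phi>. clause_true (force_clause C \<sigma>) C'}))
       \<partial>measure_pmf (draw_vars \<rho> (V - vars C))) \<partial>measure_pmf (select_clause \<Phi> \<rho>))"
proof -
  have "ennreal (success_prob V \<Phi> \<rho>) =
      (\<integral>\<^sup>+L. ennreal (1 / real L) \<partial>measure_pmf (num_satisfied_pmf V \<Phi> \<rho>))"
    unfolding success_prob_def
    by (rule nn_integral_eq_integral[symmetric, OF integrable_success]) simp
  also have "\<dots> = (\<integral>\<^sup>+C. (\<integral>\<^sup>+\<sigma>.
     ennreal (1 / real (card {C' \<in> \<Phi>. clause_true (force_clause C \<sigma>) C'}))
       \<partial>measure_pmf (draw_vars \<rho> (V - vars C))) \<partial>measure_pmf (select_clause \<Phi> \<rho>))"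
    by (simp add: num_satisfied_pmf_def)
  finally show ?thesis .
qed

text \<open>Averaging the conditional success probabilities over the selected clause gives p for
  every \<pi>, and a probability measure on two points is determined by one of them.\<close>

lemma trial_eq_bernoulli:
  assumes \<pi>: "\<pi> \<in> permutations_of_set \<Phi>"
  shows "trial \<Phi> \<rho> \<pi> = measure_pmf (bernoulli_pmf (success_prob V \<Phi> \<rho>))"
proof -
  interpret prob_space "trial \<Phi> \<rho> \<pi>"
    by (rule prob_space_trial)
  have space: "space (trial \<Phi> \<rho> \<pi>) = UNIV"
    using sets_eq_imp_space_eq[OF sets_trial] by simp
  have "emeasure (trial \<Phi> \<rho> \<pi>) {True} =
      (\<integral>\<^sup>+C. emeasure (trial_given \<rho> \<pi> C) {True} \<partial>measure_pmf (select_clause \<Phi> \<rho>))"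
    unfolding trial_eq by (rule emeasure_bind[OF _ measurable_trial_given]) auto
  also have "\<dots> = ennreal (success_prob V \<Phi> \<rho>)"
    unfolding ennreal_success_prob
  proof (rule nn_integral_cong_AE, unfold AE_measure_pmf_iff, rule ballI)
    fix C assume "C \<in> set_pmf (select_clause \<Phi> \<rho>)"
    with set_select_clause have "C \<in> \<Phi>"
      by auto
    then show "emeasure (trial_given \<rho> \<pi> C) {True} =
      (\<integral>\<^sup>+\<sigma>. ennreal (1 / real (card {C' \<in> \<Phi>. clause_true (force_clause C \<sigma>) C'}))
       \<partial>measure_pmf (draw_vars \<rho> (V - vars C)))"
      by (rule emeasure_trial_given[OF dnf _ \<pi>])
  qed
  finally have "prob {True} = success_prob V \<Phi> \<rho>"
    using success_prob_pos by (simp add: measure_def)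
  moreover have "prob {False} = 1 - prob {True}"
  proof -
    have "{False} = space (trial \<Phi> \<rho> \<pi>) - {True}"
      by (auto simp: space)
    then show ?thesis
      using prob_compl[of "{True}"] by (simp add: sets_trial)
  qed
  ultimately have *: "prob {b} = pmf (bernoulli_pmf (success_prob V \<Phi> \<rho>)) b" for b
    using success_prob_pos success_prob_le_1 by (cases b) simp_all
  show ?thesis
  proof (rule measure_eqI_countable[where A = UNIV])
    fix b
    show "emeasure (trial \<Phi> \<rho> \<pi>) {b} = emeasure (measure_pmf (bernoulli_pmf (success_prob V \<Phi> \<rho>))) {b}"
      by (simp add: emeasure_eq_measure * emeasure_pmf_single)
  qed (simp_all add: sets_trial)
qed

section \<open>The identity between mu and p\<close>

text \<open>On the event that \<open>C\<close> holds, its variables take one fixed pattern, of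
  probability \<open>clause_weight \<rho> C\<close>, and the others stay independent of it. The
  function \<open>f\<close> will be the reciprocal of the number of true clauses.\<close>

lemma nn_integral_clause_true:
  assumes C: "C \<in> \<Phi>"
  shows "(\<integral>\<^sup>+\<sigma>. indicator {\<sigma>. clause_true \<sigma> C} \<sigma> * f \<sigma> \<partial>measure_pmf (draw_vars \<rho> V)) =
    ennreal (clause_weight \<rho> C) * (\<integral>\<^sup>+\<sigma>. f (force_clause C \<sigma>) \<partial>measure_pmf (draw_vars \<rho> (V - vars C)))"
proof -
  define \<tau>\<^sub>0 where "\<tau>\<^sub>0 = (\<lambda>v. Pos v \<in> C)"
  let ?I = "\<integral>\<^sup>+\<sigma>. f (force_clause C \<sigma>) \<partial>measure_pmf (draw_vars \<rho> (V - vars C))"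
  have V: "finite V" "vars C \<subseteq> V" and no_compl: "\<not> (\<exists>v. Pos v \<in> C \<and> Neg v \<in> C)"
    using dnf C by (auto simp: dnf_formula_def)
  have fin: "finite (vars C)"
    using V by (rule rev_finite_subset)
  have split: "draw_vars \<rho> V = bind_pmf (draw_vars \<rho> (vars C))
      (\<lambda>\<tau>. map_pmf (\<lambda>\<sigma> v. if v \<in> vars C then \<tau> v else \<sigma> v) (draw_vars \<rho> (V - vars C)))"
    using draw_vars_Un[of "vars C" "V - vars C" \<rho>] V fin by (simp add: Un_absorb1)
  have force: "clause_true (\<lambda>v. if v \<in> vars C then \<tau> v else \<sigma> v) C \<longleftrightarrow> \<tau> = \<tau>\<^sub>0"
    if "\<tau> \<in> set_pmf (draw_vars \<rho> (vars C))" for \<tau> \<sigma>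
  proof -
    \<comment> \<open>The dummy value \<open>False\<close> outside \<open>vars C\<close> agrees with
      \<open>\<tau>\<^sub>0\<close>, so agreement on \<open>vars C\<close> becomes equality of
      functions.\<close>
    have outside: "\<not> \<tau> v" if "v \<notin> vars C" for v
      using \<open>\<tau> \<in> _\<close> that set_Pi_pmf_subset'[OF fin, of False] by (auto simp: draw_vars_def PiE_dflt_def)
    have "clause_true (\<lambda>v. if v \<in> vars C then \<tau> v else \<sigma> v) C \<longleftrightarrow> (\<forall>a\<in>C. \<tau> (var_of a) = sign_of a)"
      by (auto simp: clause_true_def vars_def)
    also have "\<dots> \<longleftrightarrow> (\<forall>v\<in>vars C. \<tau> v = (Pos v \<in> C))"
    proof -
      have "sign_of a = (Pos (var_of a) \<in> C)" if "a \<in> C" for a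
        using that no_compl by (cases a) auto
      then show ?thesis
        by (auto simp: vars_def)
    qed
    also have "\<dots> \<longleftrightarrow> \<tau> = \<tau>\<^sub>0"
      using outside by (force simp: fun_eq_iff \<tau>\<^sub>0_def vars_def)
    finally show ?thesis .
  qed
  have force0: "(\<lambda>v. if v \<in> vars C then \<tau>\<^sub>0 v else \<sigma> v) = force_clause C \<sigma>" for \<sigma>
    by (simp add: force_clause_def \<tau>\<^sub>0_def)
  have "(\<integral>\<^sup>+\<sigma>. indicator {\<sigma>. clause_true \<sigma> C} \<sigma> * f \<sigma> \<partial>measure_pmf (draw_vars \<rho> V)) =
      (\<integral>\<^sup>+\<tau>. (\<integral>\<^sup>+\<sigma>. indicator {\<sigma>. clause_true \<sigma> C} (\<lambda>v. if v \<in> vars C then \<tau> v else \<sigma> v) *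
        f (\<lambda>v. if v \<in> vars C then \<tau> v else \<sigma> v) \<partial>measure_pmf (draw_vars \<rho> (V - vars C)))
        \<partial>measure_pmf (draw_vars \<rho> (vars C)))"
    by (simp add: split)
  also have "\<dots> = (\<integral>\<^sup>+\<tau>. indicator {\<tau>\<^sub>0} \<tau> * ?I \<partial>measure_pmf (draw_vars \<rho> (vars C)))"
  proof (rule nn_integral_cong_AE, unfold AE_measure_pmf_iff, rule ballI)
    fix \<tau> assume \<tau>: "\<tau> \<in> set_pmf (draw_vars \<rho> (vars C))"
    show "(\<integral>\<^sup>+\<sigma>. indicator {\<sigma>. clause_true \<sigma> C} (\<lambda>v. if v \<in> vars C then \<tau> v else \<sigma> v) *
        f (\<lambda>v. if v \<in> vars C then \<tau> v else \<sigma> v) \<partial>measure_pmf (draw_vars \<rho> (V - vars C))) =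
        indicator {\<tau>\<^sub>0} \<tau> * ?I"
    proof (cases "\<tau> = \<tau>\<^sub>0")
      case True
      show ?thesis
        unfolding True force0 by (simp add: clause_true_force_clause[OF no_compl])
    next
      case False
      then show ?thesis
        using force[OF \<tau>] by (simp add: indicator_def)
    qed
  qed
  also have "\<dots> = ennreal (pmf (draw_vars \<rho> (vars C)) \<tau>\<^sub>0) * ?I"
    by (simp add: nn_integral_multc emeasure_pmf_single)
  also have "pmf (draw_vars \<rho> (vars C)) \<tau>\<^sub>0 = clause_weight \<rho> C"
  proof -
    have "pmf (draw_vars \<rho> (vars C)) \<tau>\<^sub>0 = (\<Prod>v\<in>vars C. pmf (bernoulli_pmf (\<rho> v)) (\<tau>\<^sub>0 v))"
      unfolding draw_vars_def using fin by (intro pmf_Pi') (force simp: \<tau>\<^sub>0_def vars_def)+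
    also have "\<dots> = (\<Prod>a\<in>C. pmf (bernoulli_pmf (\<rho> (var_of a))) (\<tau>\<^sub>0 (var_of a)))"
      unfolding vars_def
    proof (subst prod.reindex)
      \<comment> \<open>Without complementary pairs, distinct literals of \<open>C\<close> have
        distinct variables; the product over variables is then one over literals.\<close>
      show "inj_on var_of C"
      proof (rule inj_onI)
        fix a b assume "a \<in> C" "b \<in> C" "var_of a = var_of b"
        then show "a = b"
          using no_compl by (cases a; cases b) auto
      qed
    qed simp
    also have "\<dots> = clause_weight \<rho> C"
      unfolding clause_weight_def
    proof (rule prod.cong[OF refl])
      fix a assume "a \<in> C"
      moreover from this have "var_of a \<in> V"
        using V by (auto simp: vars_def)
      then have "0 \<le> \<rho> (var_of a)" "\<rho> (var_of a) \<le> 1"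
        using \<rho> by auto
      ultimately show "pmf (bernoulli_pmf (\<rho> (var_of a))) (\<tau>\<^sub>0 (var_of a)) = lit_weight \<rho> a"
        using no_compl by (cases a; cases "\<tau>\<^sub>0 (var_of a)") (auto simp: \<tau>\<^sub>0_def)
    qed
    finally show ?thesis .
  qed
  finally show ?thesis .
qed

text \<open>Multiplying p by the total weight cancels the normalisation of the clause choice. What
  remains counts each satisfying assignment once per true clause, each time with weight one over the
  number of true clauses.\<close>

lemma dnf_prob_eq: "dnf_prob V \<Phi> \<rho> = success_prob V \<Phi> \<rho> * formula_weight \<rho> \<Phi>"
proof -
  define L where "L \<sigma> = card {C \<in> \<Phi>. clause_true \<sigma> C}" for \<sigma>
  let ?D = "draw_vars \<rho>" and ?W = "formula_weight \<rho> \<Phi>"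
  let ?J = "\<lambda>C. \<integral>\<^sup>+\<sigma>. ennreal (1 / real (L (force_clause C \<sigma>))) \<partial>measure_pmf (?D (V - vars C))"
  have fin: "finite \<Phi>"
    by (rule finite_dnf_formula[OF dnf])
  have "ennreal (success_prob V \<Phi> \<rho>) = (\<Sum>C\<in>\<Phi>. ?J C * ennreal (pmf (select_clause \<Phi> \<rho>) C))"
    unfolding ennreal_success_prob L_def[symmetric]
    using fin set_select_clause by (intro nn_integral_measure_pmf_support) auto
  then have "ennreal ?W * ennreal (success_prob V \<Phi> \<rho>) =
      (\<Sum>C\<in>\<Phi>. ennreal ?W * (?J C * ennreal (pmf (select_clause \<Phi> \<rho>) C)))"
    by (simp add: sum_distrib_left)
  also have "\<dots> = (\<Sum>C\<in>\<Phi>. ennreal (clause_weight \<rho> C) * ?J C)"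
  proof (rule sum.cong[OF refl])
    fix C assume C: "C \<in> \<Phi>"
    have "ennreal ?W * ennreal (pmf (select_clause \<Phi> \<rho>) C) = ennreal (clause_weight \<rho> C)"
      using C weight by (simp add: pmf_select_clause flip: ennreal_mult')
    then show "ennreal ?W * (?J C * ennreal (pmf (select_clause \<Phi> \<rho>) C)) =
        ennreal (clause_weight \<rho> C) * ?J C"
      by (simp only: mult.left_commute[of "ennreal ?W"]) (rule mult.commute)
  qed
  also have "\<dots> = (\<Sum>C\<in>\<Phi>. \<integral>\<^sup>+\<sigma>. indicator {\<sigma>. clause_true \<sigma> C} \<sigma> * ennreal (1 / real (L \<sigma>))
      \<partial>measure_pmf (?D V))"
    by (simp add: nn_integral_clause_true)
  also have "\<dots> = (\<integral>\<^sup>+\<sigma>. (\<Sum>C\<in>\<Phi>. indicator {\<sigma>. clause_true \<sigma> C} \<sigma> * ennreal (1 / real (L \<sigma>)))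
      \<partial>measure_pmf (?D V))"
    by (simp add: nn_integral_sum)
  also have "\<dots> = (\<integral>\<^sup>+\<sigma>. indicator {\<sigma>. \<exists>C\<in>\<Phi>. clause_true \<sigma> C} \<sigma> \<partial>measure_pmf (?D V))"
  proof (rule nn_integral_cong)
    fix \<sigma>
    have "(\<Sum>C\<in>\<Phi>. indicator {\<sigma>. clause_true \<sigma> C} \<sigma> * ennreal (1 / real (L \<sigma>))) =
        of_nat (L \<sigma>) * ennreal (1 / real (L \<sigma>))"
      using fin by (simp add: indicator_def L_def Int_def flip: sum_distrib_right)
    also have "\<dots> = ennreal (real (L \<sigma>) * (1 / real (L \<sigma>)))"
      by (simp only: ennreal_of_nat_eq_real_of_nat ennreal_mult'[symmetric] of_nat_0_le_iff)
    \<comment> \<open>If no clause is true, the product is 0 because its first factor is.\<close>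
    also have "\<dots> = indicator {\<sigma>. \<exists>C\<in>\<Phi>. clause_true \<sigma> C} \<sigma>"
    proof -
      have "L \<sigma> \<noteq> 0 \<longleftrightarrow> (\<exists>C\<in>\<Phi>. clause_true \<sigma> C)"
        using fin by (auto simp: L_def)
      then show ?thesis
        by (auto simp: indicator_def)
    qed
    finally show "(\<Sum>C\<in>\<Phi>. indicator {\<sigma>. clause_true \<sigma> C} \<sigma> * ennreal (1 / real (L \<sigma>))) =
        indicator {\<sigma>. \<exists>C\<in>\<Phi>. clause_true \<sigma> C} \<sigma>" .
  qed
  also have "\<dots> = ennreal (dnf_prob V \<Phi> \<rho>)"
    by (simp add: dnf_prob_def measure_pmf.emeasure_eq_measure)
  finally have "ennreal (?W * success_prob V \<Phi> \<rho>) = ennreal (dnf_prob V \<Phi> \<rho>)"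
    using weight by (simp add: ennreal_mult')
  then show ?thesis
    using weight success_prob_pos by (simp add: dnf_prob_def mult.commute)
qed

section \<open>Runs as Bernoulli sequences\<close>

lemma runs_given_eq_bernoulli:
  assumes "\<pi> \<in> permutations_of_set \<Phi>"
  shows "runs_given \<Phi> \<rho> \<pi> = stream_space (measure_pmf (bernoulli_pmf (success_prob V \<Phi> \<rho>)))"
  using assms by (simp add: runs_given_def trial_eq_bernoulli)

text \<open>All permutations in the support of \<open>P\<close> give the same law of runs, so mixing
  over them is binding a constant.\<close>

lemma runs_eq_bernoulli:
  assumes P: "set_pmf P \<subseteq> permutations_of_set \<Phi>"
  shows "runs \<Phi> \<rho> P = stream_space (measure_pmf (bernoulli_pmf (success_prob V \<Phi> \<rho>)))"
proof -
  define M where "M = stream_space (measure_pmf (bernoulli_pmf (success_prob V \<Phi> \<rho>)))"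
  let ?S = "stream_space (count_space UNIV) :: bool stream measure"
  have prob: "prob_space (runs_given \<Phi> \<rho> \<pi>)" for \<pi>
    unfolding runs_given_def by (rule prob_space.prob_space_stream_space[OF prob_space_trial])
  have sets: "sets (runs_given \<Phi> \<rho> \<pi>) = sets ?S" for \<pi>
    unfolding runs_given_def by (rule sets_stream_space_cong[OF sets_trial])
  have probM: "prob_space M"
    unfolding M_def by (rule prob_space.prob_space_stream_space[OF measure_pmf.prob_space_axioms])
  have setsM: "sets M = sets ?S"
    unfolding M_def by (rule sets_stream_space_cong) simp
  have "runs \<Phi> \<rho> P = measure_pmf P \<bind> (\<lambda>_. M)"
    unfolding runs_def
  proof (rule bind_cong_AE[OF refl])
    show "runs_given \<Phi> \<rho> \<in> measure_pmf P \<rightarrow>\<^sub>M subprob_algebra ?S"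
      by (auto simp: measurable_def space_subprob_algebra sets prob prob_space_imp_subprob_space)
    show "(\<lambda>_. M) \<in> measure_pmf P \<rightarrow>\<^sub>M subprob_algebra ?S"
      by (auto simp: measurable_def space_subprob_algebra setsM probM prob_space_imp_subprob_space)
    show "AE \<pi> in measure_pmf P. runs_given \<Phi> \<rho> \<pi> = M"
      using P by (auto simp: AE_measure_pmf_iff M_def runs_given_eq_bernoulli)
  qed
  also have "\<dots> = M"
    by (intro bind_const' measure_pmf.prob_space_axioms prob_space_imp_subprob_space probM)
  finally show ?thesis
    by (simp add: M_def)
qed

end

section \<open>Bernoulli trials until a given number of successes\<close>

lemma successes_0 [simp]: "successes \<omega> 0 = 0"
  by (simp add: successes_def)

lemma successes_Suc: "successes \<omega> (Suc k) = successes \<omega> k + of_bool (\<omega> !! k)"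
proof -
  have "{i. i < Suc k \<and> \<omega> !! i} = {i. i < k \<and> \<omega> !! i} \<union> (if \<omega> !! k then {k} else {})"
    by (auto simp: less_Suc_eq)
  then show ?thesis
    by (auto simp: successes_def)
qed

text \<open>\<open>successes_Suc\<close> recurses at the end of the prefix, whereas the stream
  measure splits off its head.\<close>

lemma successes_Stream: "successes (b ## \<omega>) (Suc k) = of_bool b + successes \<omega> k"
  by (induction k) (simp_all add: successes_Suc)

lemma successes_mono: "k \<le> l \<Longrightarrow> successes \<omega> k \<le> successes \<omega> l"
  by (rule lift_Suc_mono_le[where f = "successes \<omega>"]) (simp_all add: successes_Suc)

lemma measurable_successes [measurable]:
  "(\<lambda>\<omega>. successes \<omega> k) \<in> stream_space (count_space UNIV) \<rightarrow>\<^sub>M count_space UNIV"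
  by (induction k) (simp_all add: successes_Suc)

text \<open>Splitting off the first trial matches the recursion of the binomial distribution. The
  set \<open>A\<close> is generalised because the first result shifts it.\<close>

lemma emeasure_successes:
  assumes p: "p \<in> {0..1}"
  defines "M \<equiv> stream_space (measure_pmf (bernoulli_pmf p))"
  shows "emeasure M {\<omega>. successes \<omega> k \<in> A} = emeasure (measure_pmf (binomial_pmf k p)) A"
proof (induction k arbitrary: A)
  have M: "sets M = sets (stream_space (count_space UNIV))"
    unfolding M_def by (rule sets_stream_space_cong) simp
  have space: "space M = UNIV"
    by (simp add: M_def space_stream_space)
  interpret M: prob_space M
    unfolding M_def
    by (rule prob_space.prob_space_stream_space[OF measure_pmf.prob_space_axioms])
  {
    case 0
    show ?case
      using p M.emeasure_space_1
      by (cases "0 \<in> A") (auto simp: binomial_pmf_0 space)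
  next
    case (Suc k)
    have [measurable]: "{\<omega>. successes \<omega> (Suc k) \<in> A} \<in> sets M"
    proof -
      have "{\<omega> \<in> space (stream_space (count_space UNIV)). successes \<omega> (Suc k) \<in> A} \<in>
          sets (stream_space (count_space UNIV))"
        by measurable
      then show ?thesis
        by (simp add: M space_stream_space)
    qed
    have "emeasure M {\<omega>. successes \<omega> (Suc k) \<in> A} =
        (\<integral>\<^sup>+b. emeasure M {\<omega>. successes (b ## \<omega>) (Suc k) \<in> A} \<partial>measure_pmf (bernoulli_pmf p))"
      unfolding M_def
      by (subst prob_space.emeasure_stream_space[OF measure_pmf.prob_space_axioms])
        (use \<open>_ \<in> sets M\<close> in \<open>simp_all add: M_def[symmetric] space\<close>)
    also have "\<dots> = (\<integral>\<^sup>+b. emeasure (measure_pmf (binomial_pmf k p)) {j. of_bool b + j \<in> A}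
        \<partial>measure_pmf (bernoulli_pmf p))"
      using Suc.IH[of "{j. of_bool _ + j \<in> A}"] by (simp add: successes_Stream)
    also have "\<dots> = emeasure (measure_pmf (binomial_pmf (Suc k) p)) A"
      using p by (simp add: binomial_pmf_Suc vimage_def of_bool_def flip: map_pmf_def)
    finally show ?case .
  }
qed

section \<open>Chernoff bounds for the binomial distribution\<close>

lemma expectation_power_binomial_pmf:
  assumes "p \<in> {0..1}"
  shows "measure_pmf.expectation (binomial_pmf k p) (\<lambda>j. y ^ j) = (1 - p + p * y) ^ k"
proof -
  have "measure_pmf.expectation (binomial_pmf k p) (\<lambda>j. y ^ j) =
      (\<Sum>j\<le>k. real (k choose j) * p ^ j * (1 - p) ^ (k - j) * y ^ j)"
    using assms by (simp add: expectation_binomial_pmf' mult_ac)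
  also have "\<dots> = (p * y + (1 - p)) ^ k"
    by (simp add: binomial_ring power_mult_distrib mult_ac)
  finally show ?thesis
    by (simp add: add_ac)
qed

text \<open>Markov's inequality for \<open>y ^ j\<close>, whose expectation is bounded through
  \<open>1 + x \<le> exp x\<close>. The condition on \<open>A\<close> covers both tails:
  \<open>j \<ge> T\<close> for \<open>y \<ge> 1\<close>, and \<open>j \<le> T\<close> for
  \<open>y \<le> 1\<close>.\<close>

lemma binomial_pmf_chernoff:
  assumes p: "p \<in> {0..1}" and "0 < y" and A: "\<And>j. j \<in> A \<Longrightarrow> y ^ T \<le> y ^ j"
  shows "measure_pmf.prob (binomial_pmf k p) A \<le> exp (real k * p * (y - 1)) / y ^ T"
proof -
  have "measure_pmf.prob (binomial_pmf k p) A =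
      measure_pmf.expectation (binomial_pmf k p) (indicator A)"
    by simp
  also have "\<dots> \<le> measure_pmf.expectation (binomial_pmf k p) (\<lambda>j. y ^ j / y ^ T)"
    using p \<open>0 < y\<close> A by (intro integral_mono integrable_measure_pmf_finite)
      (auto simp: indicator_def divide_simps)
  also have "\<dots> = (1 - p + p * y) ^ k / y ^ T"
    using p by (simp add: expectation_power_binomial_pmf)
  also have "\<dots> \<le> exp (p * (y - 1)) ^ k / y ^ T"
  proof -
    have "1 - p + p * y \<le> exp (p * (y - 1))"
      using exp_ge_add_one_self[of "p * (y - 1)"] by (simp add: algebra_simps)
    moreover have "0 \<le> 1 - p + p * y"
      using p \<open>0 < y\<close> by simp
    ultimately show ?thesis
      using \<open>0 < y\<close> by (intro divide_right_mono power_mono) auto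
  qed
  finally show ?thesis
    by (simp add: mult.assoc flip: exp_of_nat_mult)
qed

section \<open>The stopping time and its expectation\<close>

text \<open>The success count is monotone, so the times at which the loop may stop are upward
  closed, and their infimum is attained if there are any. Events about the random N thus become
  events about a fixed number of trials.\<close>

lemma num_trials_le_iff: "num_trials \<epsilon> \<delta> \<omega> \<le> enat k \<longleftrightarrow> threshold \<epsilon> \<delta> \<le> successes \<omega> k"
proof
  let ?K = "{k. \<not> successes \<omega> k < threshold \<epsilon> \<delta>}"
  assume le: "num_trials \<epsilon> \<delta> \<omega> \<le> enat k"
  have "?K \<noteq> {}"
  proof
    assume "?K = {}"
    then have "num_trials \<epsilon> \<delta> \<omega> = \<infinity>"
      unfolding num_trials_def by (simp only: image_empty Inf_empty top_enat_def)
    with le show False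
      by simp
  qed
  then have "num_trials \<epsilon> \<delta> \<omega> \<in> enat ` ?K"
    unfolding num_trials_def by (meson imageI ex_in_conv wellorder_InfI)
  then obtain l where "\<not> successes \<omega> l < threshold \<epsilon> \<delta>" "num_trials \<epsilon> \<delta> \<omega> = enat l"
    by auto
  with le show "threshold \<epsilon> \<delta> \<le> successes \<omega> k"
    using successes_mono[of l k \<omega>] by simp
next
  assume "threshold \<epsilon> \<delta> \<le> successes \<omega> k"
  then show "num_trials \<epsilon> \<delta> \<omega> \<le> enat k"
    unfolding num_trials_def by (intro INF_lower) simp
qed

text \<open>Tail-sum formula: N is the number of \<open>k\<close> below it, also when it is
  infinite.\<close>

lemma ennreal_of_enat_num_trials:
  "ennreal_of_enat (num_trials \<epsilon> \<delta> \<omega>) =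
     (\<Sum>k. indicator {\<omega>. successes \<omega> k < threshold \<epsilon> \<delta>} \<omega>)"
proof -
  let ?K = "{k. successes \<omega> k < threshold \<epsilon> \<delta>}"
  have K: "?K = {k. enat k < num_trials \<epsilon> \<delta> \<omega>}"
    using num_trials_le_iff[of \<epsilon> \<delta> \<omega>] by (auto simp flip: not_le)
  have "(\<Sum>k. indicator {\<omega>. successes \<omega> k < threshold \<epsilon> \<delta>} \<omega>) =
      (\<integral>\<^sup>+k. indicator ?K k \<partial>count_space UNIV)"
    by (subst nn_integral_count_space_nat) (auto simp: indicator_def intro!: suminf_cong)
  also have "\<dots> = emeasure (count_space UNIV) ?K"
    by simp
  also have "\<dots> = ennreal_of_enat (num_trials \<epsilon> \<delta> \<omega>)"
  proof (cases "num_trials \<epsilon> \<delta> \<omega>")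
    case (enat n)
    then have "?K = {..<n}"
      unfolding K by auto
    then show ?thesis
      by (simp add: enat ennreal_of_nat_eq_real_of_nat)
  next
    case infinity
    then have "?K = UNIV"
      unfolding K by auto
    then show ?thesis
      by (simp add: infinity)
  qed
  finally show ?thesis ..
qed

text \<open>The expected time spent with exactly \<open>j\<close> successes is the mean wait
  \<open>1 / p\<close> for the next one.\<close>

lemma suminf_pmf_binomial:
  assumes "0 < p" "p \<le> 1"
  shows "(\<Sum>k. ennreal (pmf (binomial_pmf k p) j)) = ennreal (1 / p)"
proof -
  \<comment> \<open>The negative binomial law for \<open>Suc j\<close> successes has the same
    coefficient and one more factor \<open>p\<close>. Summing it over \<open>k\<close> gives 1; the
    terms with fewer than \<open>j\<close> trials vanish.\<close>
  have *: "pmf (binomial_pmf (k + j) p) j = pmf (neg_binomial_pmf (Suc j) p) k / p" for k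
    using assms binomial_symmetric[of j "k + j"] by (simp add: pmf_neg_binomial field_simps)
  have "(\<Sum>k. ennreal (pmf (binomial_pmf k p) j)) =
      (\<Sum>k. ennreal (pmf (binomial_pmf (k + j) p) j)) + (\<Sum>k<j. ennreal (pmf (binomial_pmf k p) j))"
    by (rule suminf_offset) simp
  also have "(\<Sum>k<j. ennreal (pmf (binomial_pmf k p) j)) = 0"
    using assms by (intro sum.neutral) (simp add: binomial_eq_0)
  also have "(\<Sum>k. ennreal (pmf (binomial_pmf (k + j) p) j)) =
      (\<Sum>k. ennreal (1 / p) * ennreal (pmf (neg_binomial_pmf (Suc j) p) k))"
    using assms by (simp add: * flip: ennreal_mult')
  also have "\<dots> = ennreal (1 / p) * (\<integral>\<^sup>+k. pmf (neg_binomial_pmf (Suc j) p) k \<partial>count_space UNIV)"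
    by (simp add: nn_integral_count_space_nat)
  finally show ?thesis
    by (simp add: nn_integral_pmf)
qed

text \<open>By the tail sum, the loop runs while the success count is one of the values below T, and
  each value lasts \<open>1 / p\<close> trials on average.\<close>

lemma expected_trials_bernoulli:
  assumes p: "0 < p" "p \<le> 1"
  shows "expected_trials (stream_space (measure_pmf (bernoulli_pmf p))) \<epsilon> \<delta> =
    ennreal (real (threshold \<epsilon> \<delta>) / p)"
proof -
  define M where "M = stream_space (measure_pmf (bernoulli_pmf p))"
  have [measurable_cong]: "sets M = sets (stream_space (count_space UNIV))"
    unfolding M_def by (rule sets_stream_space_cong) simp
  have space: "space M = UNIV"
    by (simp add: M_def space_stream_space)
  have meas: "{\<omega>. successes \<omega> k < threshold \<epsilon> \<delta>} \<in> sets M" for k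
  proof -
    have "{\<omega> \<in> space M. successes \<omega> k < threshold \<epsilon> \<delta>} \<in> sets M"
      by measurable
    then show ?thesis
      by (simp add: space)
  qed
  have "expected_trials M \<epsilon> \<delta> = (\<Sum>k. emeasure M {\<omega>. successes \<omega> k < threshold \<epsilon> \<delta>})"
    unfolding expected_trials_def ennreal_of_enat_num_trials
    using meas by (subst nn_integral_suminf) simp_all
  also have "\<dots> = (\<Sum>k. emeasure (measure_pmf (binomial_pmf k p)) {..<threshold \<epsilon> \<delta>})"
    using p emeasure_successes[of p _ "{..<threshold \<epsilon> \<delta>}"] by (simp add: M_def)
  also have "\<dots> = (\<Sum>k. \<Sum>j<threshold \<epsilon> \<delta>. ennreal (pmf (binomial_pmf k p) j))"
    by (simp add: measure_pmf.emeasure_eq_measure measure_measure_pmf_finite)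
  also have "\<dots> = (\<Sum>j<threshold \<epsilon> \<delta>. \<Sum>k. ennreal (pmf (binomial_pmf k p) j))"
    by (rule suminf_sum) simp
  also have "\<dots> = (\<Sum>j<threshold \<epsilon> \<delta>. ennreal (1 / p))"
    using p by (simp only: suminf_pmf_binomial)
  also have "\<dots> = ennreal (real (threshold \<epsilon> \<delta>) / p)"
    using p by (simp add: ennreal_of_nat_eq_real_of_nat flip: ennreal_mult')
  finally show ?thesis
    by (simp add: M_def)
qed

section \<open>The order of magnitude of the threshold\<close>

text \<open>The function vanishes at 0 and has derivative \<open>x / (1 + x)\<^sup>2\<close>, which
  lies between \<open>x / 4\<close> and \<open>x\<close> on the unit interval.\<close>

lemma upper_base_bounds:
  fixes \<epsilon> :: real
  assumes "0 < \<epsilon>" "\<epsilon> < 1"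
  shows "\<epsilon>\<^sup>2 / 8 \<le> ln (1 + \<epsilon>) - \<epsilon> / (1 + \<epsilon>)" "ln (1 + \<epsilon>) - \<epsilon> / (1 + \<epsilon>) \<le> \<epsilon>\<^sup>2 / 2"
proof -
  let ?f = "\<lambda>x::real. ln (1 + x) - x / (1 + x)"
  have D: "(?f has_real_derivative x / (1 + x)\<^sup>2) (at x)" if "0 \<le> x" for x
    using that
    by (auto intro!: derivative_eq_intros)
      (simp add: divide_simps, simp add: algebra_simps power2_eq_square)
  have "?f 0 - 0\<^sup>2 / 8 \<le> ?f \<epsilon> - \<epsilon>\<^sup>2 / 8"
  proof (rule DERIV_nonneg_imp_nondecreasing[where f = "\<lambda>x. ?f x - x\<^sup>2 / 8"])
    fix x assume x: "0 \<le> x" "x \<le> \<epsilon>"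
    have "(1 + x)\<^sup>2 \<le> 2\<^sup>2"
      using x assms by (intro power_mono) auto
    then have "x / 4 \<le> x / (1 + x)\<^sup>2"
      using x by (intro divide_left_mono) auto
    moreover have "((\<lambda>x. ?f x - x\<^sup>2 / 8) has_real_derivative x / (1 + x)\<^sup>2 - x / 4) (at x)"
      by (rule derivative_eq_intros D refl x | simp)+
    ultimately show "\<exists>d. ((\<lambda>x. ?f x - x\<^sup>2 / 8) has_real_derivative d) (at x) \<and> 0 \<le> d"
      by (intro exI conjI) auto
  qed (use assms in auto)
  then show "\<epsilon>\<^sup>2 / 8 \<le> ?f \<epsilon>"
    by simp
  have "0\<^sup>2 / 2 - ?f 0 \<le> \<epsilon>\<^sup>2 / 2 - ?f \<epsilon>"
  proof (rule DERIV_nonneg_imp_nondecreasing[where f = "\<lambda>x. x\<^sup>2 / 2 - ?f x"])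
    fix x assume x: "0 \<le> x" "x \<le> \<epsilon>"
    have "1 \<le> (1 + x)\<^sup>2"
      using x by (intro one_le_power) auto
    then have "x / (1 + x)\<^sup>2 \<le> x / 1"
      using x by (intro divide_left_mono) auto
    moreover have "((\<lambda>x. x\<^sup>2 / 2 - ?f x) has_real_derivative x - x / (1 + x)\<^sup>2) (at x)"
      by (rule derivative_eq_intros D refl x | simp)+
    ultimately show "\<exists>d. ((\<lambda>x. x\<^sup>2 / 2 - ?f x) has_real_derivative d) (at x) \<and> 0 \<le> d"
      by (intro exI conjI) auto
  qed (use assms in auto)
  then show "?f \<epsilon> \<le> \<epsilon>\<^sup>2 / 2"
    by simp
qed

text \<open>Here the derivative is \<open>x / (1 - x)\<^sup>2 \<ge> x\<close>. The bound makes the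
  second summand small; \<open>threshold_lower\<close> works with the first one alone.\<close>

lemma lower_base_bound:
  fixes \<epsilon> :: real
  assumes "0 < \<epsilon>" "\<epsilon> < 1"
  shows "\<epsilon>\<^sup>2 / 2 \<le> \<epsilon> / (1 - \<epsilon>) + ln (1 - \<epsilon>)"
proof -
  let ?f = "\<lambda>x::real. x / (1 - x) + ln (1 - x)"
  have D: "(?f has_real_derivative x / (1 - x)\<^sup>2) (at x)" if "x < 1" for x
    using that
    by (auto intro!: derivative_eq_intros)
      (simp add: divide_simps, simp add: algebra_simps power2_eq_square)
  have "?f 0 - 0\<^sup>2 / 2 \<le> ?f \<epsilon> - \<epsilon>\<^sup>2 / 2"
  proof (rule DERIV_nonneg_imp_nondecreasing[where f = "\<lambda>x. ?f x - x\<^sup>2 / 2"])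
    fix x assume x: "0 \<le> x" "x \<le> \<epsilon>"
    then have x1: "x < 1"
      using assms by simp
    have "(1 - x)\<^sup>2 \<le> 1"
      using x x1 by (intro power_le_one) auto
    then have "x / 1 \<le> x / (1 - x)\<^sup>2"
      using x x1 by (intro divide_left_mono) auto
    moreover have "((\<lambda>x. ?f x - x\<^sup>2 / 2) has_real_derivative x / (1 - x)\<^sup>2 - x) (at x)"
      by (rule derivative_eq_intros D refl x1 | simp)+
    ultimately show "\<exists>d. ((\<lambda>x. ?f x - x\<^sup>2 / 2) has_real_derivative d) (at x) \<and> 0 \<le> d"
      by (intro exI conjI) auto
  qed (use assms in auto)
  then show ?thesis
    by simp
qed

lemma threshold_bases:
  fixes \<epsilon> :: real
  assumes "0 < \<epsilon>" "\<epsilon> < 1"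
  shows "exp (\<epsilon> / (1 + \<epsilon>)) / (1 + \<epsilon>) = exp (- (ln (1 + \<epsilon>) - \<epsilon> / (1 + \<epsilon>)))"
    and "exp (- \<epsilon> / (1 - \<epsilon>)) / (1 - \<epsilon>) = exp (- (\<epsilon> / (1 - \<epsilon>) + ln (1 - \<epsilon>)))"
  using assms by (simp_all add: exp_diff exp_minus exp_add divide_inverse)

text \<open>An explicit exponent meeting the condition shows that the minimum exists and bounds it
  from above.\<close>

lemma threshold_spec:
  assumes "0 < \<epsilon>" "\<epsilon> < 1" "0 < \<delta>"
  shows "(exp (\<epsilon> / (1 + \<epsilon>)) / (1 + \<epsilon>)) ^ threshold \<epsilon> \<delta> +
      (exp (- \<epsilon> / (1 - \<epsilon>)) / (1 - \<epsilon>)) ^ threshold \<epsilon> \<delta> \<le> \<delta>"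
    and "threshold \<epsilon> \<delta> \<le> nat \<lceil>8 * ln (2 / \<delta>) / \<epsilon>\<^sup>2\<rceil>"
proof -
  let ?P = "\<lambda>T. (exp (\<epsilon> / (1 + \<epsilon>)) / (1 + \<epsilon>)) ^ T + (exp (- \<epsilon> / (1 - \<epsilon>)) / (1 - \<epsilon>)) ^ T \<le> \<delta>"
  \<comment> \<open>Both bases are at most \<open>exp (- \<epsilon>\<^sup>2 / 8)\<close>, so this
    exponent brings each summand down to \<open>\<delta> / 2\<close>.\<close>
  define T where "T = nat \<lceil>8 * ln (2 / \<delta>) / \<epsilon>\<^sup>2\<rceil>"
  have "8 * ln (2 / \<delta>) / \<epsilon>\<^sup>2 \<le> real T"
    unfolding T_def by linarith
  then have T: "ln (2 / \<delta>) \<le> real T * (\<epsilon>\<^sup>2 / 8)"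
    using assms by (simp add: field_simps)
  have *: "exp (- c) ^ T \<le> \<delta> / 2" if "\<epsilon>\<^sup>2 / 8 \<le> c" for c
  proof -
    have "ln (2 / \<delta>) \<le> real T * c"
      using T that by (meson mult_left_mono of_nat_0_le_iff order_trans)
    then have "exp (- (real T * c)) \<le> exp (- ln (2 / \<delta>))"
      by simp
    also have "\<dots> = \<delta> / 2"
      using assms by (simp add: exp_minus)
    finally show ?thesis
      by (simp flip: exp_of_nat_mult)
  qed
  have "\<epsilon>\<^sup>2 / 8 \<le> \<epsilon> / (1 - \<epsilon>) + ln (1 - \<epsilon>)"
    using lower_base_bound[of \<epsilon>] assms zero_le_power2[of \<epsilon>] by linarith
  from add_mono[OF *[OF upper_base_bounds(1)[OF assms(1,2)]] *[OF this]] have "?P T"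
    using assms by (simp only: threshold_bases field_sum_of_halves)
  then show "?P (threshold \<epsilon> \<delta>)" "threshold \<epsilon> \<delta> \<le> T"
    unfolding threshold_def by (rule LeastI, rule Least_le)
qed

text \<open>As \<delta> stays below 3/4, \<open>ln (1 / \<delta>)\<close> is bounded away from 0 and
  absorbs both the \<open>ln 2\<close> in \<open>ln (2 / \<delta>)\<close> and the rounding up. The
  constant is 8 * 4 + 4.\<close>

lemma threshold_upper:
  assumes "0 < \<epsilon>" "\<epsilon> < 1" "0 < \<delta>" "\<delta> < 3/4"
  shows "real (threshold \<epsilon> \<delta>) \<le> 36 * (ln (1 / \<delta>) / \<epsilon>\<^sup>2)"
proof -
  have l43: "ln (4 / 3) \<le> ln (1 / \<delta>)"
    using assms by (simp add: field_simps)
  \<comment> \<open>Since 2 is less than 64/27, \<open>ln 2\<close> is at most three times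
    \<open>ln (4 / 3)\<close>, hence at most \<open>3 * ln (1 / \<delta>)\<close>.\<close>
  have "ln (2::real) \<le> ln ((4 / 3) ^ 3)"
    by (subst ln_le_cancel_iff) (simp_all add: power3_eq_cube)
  also have "\<dots> = 3 * ln (4 / 3)"
    by (subst ln_realpow) simp_all
  finally have "ln (2 / \<delta>) \<le> 4 * ln (1 / \<delta>)"
    using l43 assms by (simp add: ln_div)
  then have 1: "8 * ln (2 / \<delta>) / \<epsilon>\<^sup>2 \<le> 8 * (4 * ln (1 / \<delta>)) / \<epsilon>\<^sup>2"
    by (intro divide_right_mono mult_left_mono) auto
  have "1 / 4 \<le> ln (1 / \<delta>)"
    using assms ln_le_minus_one[of \<delta>] by (simp add: ln_div)
  moreover have "\<epsilon>\<^sup>2 \<le> 1"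
    using assms by (intro power_le_one) auto
  ultimately have "\<epsilon>\<^sup>2 \<le> 4 * ln (1 / \<delta>)"
    by linarith
  then have 2: "1 \<le> 4 * ln (1 / \<delta>) / \<epsilon>\<^sup>2"
    using assms by (simp add: field_simps)
  have "0 \<le> 8 * ln (2 / \<delta>) / \<epsilon>\<^sup>2"
    using assms by (auto intro!: divide_nonneg_nonneg)
  then have "real (threshold \<epsilon> \<delta>) \<le> 8 * ln (2 / \<delta>) / \<epsilon>\<^sup>2 + 1"
    using threshold_spec(2)[of \<epsilon> \<delta>] assms by linarith
  also have "\<dots> \<le> 8 * (4 * ln (1 / \<delta>)) / \<epsilon>\<^sup>2 + 4 * ln (1 / \<delta>) / \<epsilon>\<^sup>2"
    using 1 2 by (rule add_mono)
  also have "\<dots> = 36 * (ln (1 / \<delta>) / \<epsilon>\<^sup>2)"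
    by simp
  finally show ?thesis .
qed

text \<open>The first summand alone must be at most \<delta>, and its base is at least
  \<open>exp (- \<epsilon>\<^sup>2 / 2)\<close>.\<close>

lemma threshold_lower:
  assumes "0 < \<epsilon>" "\<epsilon> < 1" "0 < \<delta>"
  shows "2 * (ln (1 / \<delta>) / \<epsilon>\<^sup>2) \<le> real (threshold \<epsilon> \<delta>)"
proof -
  let ?a = "ln (1 + \<epsilon>) - \<epsilon> / (1 + \<epsilon>)"
  have "exp (- ?a) ^ threshold \<epsilon> \<delta> \<le> \<delta>"
    using threshold_spec(1)[OF assms]
    unfolding threshold_bases[OF assms(1,2)]
    by (rule order_trans[rotated]) simp
  then have "exp (- (real (threshold \<epsilon> \<delta>) * ?a)) \<le> \<delta>"
    by (simp only: mult_minus_right flip: exp_of_nat_mult)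
  then have "- (real (threshold \<epsilon> \<delta>) * ?a) \<le> ln \<delta>"
    using assms by (simp add: ln_ge_iff)
  then have "ln (1 / \<delta>) \<le> real (threshold \<epsilon> \<delta>) * ?a"
    using assms by (simp add: ln_div)
  also have "\<dots> \<le> real (threshold \<epsilon> \<delta>) * (\<epsilon>\<^sup>2 / 2)"
    using upper_base_bounds(2)[of \<epsilon>] assms by (intro mult_left_mono) auto
  finally show ?thesis
    using assms by (simp add: field_simps)
qed

section \<open>Accuracy of the estimate\<close>

lemma eps_delta_approx_bernoulli:
  fixes p :: real
  assumes p: "0 < p" "p \<le> 1" and \<epsilon>: "0 < \<epsilon>" "\<epsilon> < 1" and \<delta>: "0 < \<delta>" "\<delta> < 2"
    and W: "0 < formula_weight \<rho> \<Phi>"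
  shows "eps_delta_approx (stream_space (measure_pmf (bernoulli_pmf p)))
    (mu_estimate \<Phi> \<rho> \<epsilon> \<delta>) (p * formula_weight \<rho> \<Phi>) \<epsilon> \<delta>"
proof -
  define M where "M = stream_space (measure_pmf (bernoulli_pmf p))"
  define T where "T = threshold \<epsilon> \<delta>"
  define W where "W = formula_weight \<rho> \<Phi>"
  \<comment> \<open>The estimate is too large iff N is strictly below
    \<open>T / (p * (1 + \<epsilon>))\<close>, hence the ceiling minus one; it is too small iff N
    strictly exceeds \<open>T / (p * (1 - \<epsilon>))\<close>, hence the floor.\<close>
  define k\<^sub>1 where "k\<^sub>1 = nat (\<lceil>real T / (p * (1 + \<epsilon>))\<rceil> - 1)"
  define k\<^sub>2 where "k\<^sub>2 = nat \<lfloor>real T / (p * (1 - \<epsilon>))\<rfloor>"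
  interpret M: prob_space M
    unfolding M_def
    by (rule prob_space.prob_space_stream_space[OF measure_pmf.prob_space_axioms])
  have [measurable_cong]: "sets M = sets (stream_space (count_space UNIV))"
    unfolding M_def by (rule sets_stream_space_cong) simp
  have space: "space M = UNIV"
    by (simp add: M_def space_stream_space)
  note spec = threshold_spec(1)[OF \<epsilon> \<delta>(1), folded T_def]
  \<comment> \<open>For T = 0 both powers are 1 and their sum exceeds \<delta>.\<close>
  have "T \<noteq> 0"
    using spec \<delta> by (intro notI) simp
  have "0 < real T / (p * (1 + \<epsilon>))" "0 < real T / (p * (1 - \<epsilon>))"
    using p \<epsilon> \<open>T \<noteq> 0\<close> by (auto intro!: divide_pos_pos mult_pos_pos)
  then have k\<^sub>1: "real k\<^sub>1 < real T / (p * (1 + \<epsilon>))" "n \<le> k\<^sub>1 \<longleftrightarrow> real n < real T / (p * (1 + \<epsilon>))"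
    and k\<^sub>2: "real T / (p * (1 - \<epsilon>)) < real k\<^sub>2 + 1" "n \<le> k\<^sub>2 \<longleftrightarrow> real n \<le> real T / (p * (1 - \<epsilon>))" for n
    unfolding k\<^sub>1_def k\<^sub>2_def by linarith+
  define Bad\<^sub>1 where "Bad\<^sub>1 = {\<omega>. successes \<omega> k\<^sub>1 \<in> {T..}}"
  define Bad\<^sub>2 where "Bad\<^sub>2 = {\<omega>. successes \<omega> k\<^sub>2 \<in> {..<T}}"
  have meas: "{\<omega>. successes \<omega> k \<in> A} \<in> sets M" for k A
  proof -
    have "{\<omega> \<in> space M. successes \<omega> k \<in> A} \<in> sets M"
      by measurable
    then show ?thesis
      by (simp add: space)
  qed
  have prob: "M.prob {\<omega>. successes \<omega> k \<in> A} = measure_pmf.prob (binomial_pmf k p) A" for k A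
    using emeasure_successes[of p k A] p by (simp add: M_def measure_def)
  \<comment> \<open>A terminating run is accurate iff N is greater than \<open>k\<^sub>1\<close> and
    at most \<open>k\<^sub>2\<close>. A run that never stops lies in
    \<open>Bad\<^sub>2\<close>.\<close>
  have good: "(\<exists>x. mu_estimate \<Phi> \<rho> \<epsilon> \<delta> \<omega> = Some x \<and> p * W * (1 - \<epsilon>) \<le> x \<and> x \<le> p * W * (1 + \<epsilon>)) \<longleftrightarrow>
      \<omega> \<notin> Bad\<^sub>1 \<union> Bad\<^sub>2" for \<omega>
  proof (cases "num_trials \<epsilon> \<delta> \<omega>")
    case (enat n)
    have "n \<noteq> 0"
      using num_trials_le_iff[of \<epsilon> \<delta> \<omega> 0] enat \<open>T \<noteq> 0\<close> by (auto simp: T_def)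
    have "p * W * (1 - \<epsilon>) \<le> W * (real T / real n) \<longleftrightarrow> p * (1 - \<epsilon>) \<le> real T / real n"
      using mult_le_cancel_left_pos[OF W[folded W_def], of "p * (1 - \<epsilon>)" "real T / real n"]
      by (simp only: mult_ac)
    also have "\<dots> \<longleftrightarrow> n \<le> k\<^sub>2"
      using p \<epsilon> \<open>n \<noteq> 0\<close> by (simp add: k\<^sub>2 field_simps)
    finally have "p * W * (1 - \<epsilon>) \<le> W * (real T / real n) \<longleftrightarrow> n \<le> k\<^sub>2" .
    moreover have "W * (real T / real n) \<le> p * W * (1 + \<epsilon>) \<longleftrightarrow> \<not> n \<le> k\<^sub>1"
    proof -
      have "W * (real T / real n) \<le> p * W * (1 + \<epsilon>) \<longleftrightarrow> real T / real n \<le> p * (1 + \<epsilon>)"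
        using mult_le_cancel_left_pos[OF W[folded W_def], of "real T / real n" "p * (1 + \<epsilon>)"]
        by (simp only: mult_ac)
      also have "\<dots> \<longleftrightarrow> \<not> n \<le> k\<^sub>1"
        using mult_pos_pos[of p "1 + \<epsilon>"] p \<epsilon> \<open>n \<noteq> 0\<close>
        by (simp add: k\<^sub>1 not_less pos_divide_le_eq mult.commute)
      finally show ?thesis .
    qed
    moreover have le: "n \<le> k \<longleftrightarrow> T \<le> successes \<omega> k" for k
      using num_trials_le_iff[of \<epsilon> \<delta> \<omega> k] by (simp add: enat T_def)
    have "\<omega> \<in> Bad\<^sub>1 \<longleftrightarrow> n \<le> k\<^sub>1" "\<omega> \<in> Bad\<^sub>2 \<longleftrightarrow> \<not> n \<le> k\<^sub>2"
      unfolding le Bad\<^sub>1_def Bad\<^sub>2_def by auto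
    moreover have "mu_estimate \<Phi> \<rho> \<epsilon> \<delta> \<omega> = Some (W * (real T / real n))"
      by (simp add: mu_estimate_def enat T_def W_def)
    ultimately show ?thesis
      by (metis Un_iff option.inject)
  next
    case infinity
    then have "\<omega> \<in> Bad\<^sub>2"
      using num_trials_le_iff[of \<epsilon> \<delta> \<omega> k\<^sub>2] by (simp add: Bad\<^sub>2_def T_def)
    then show ?thesis
      by (simp add: mu_estimate_def infinity)
  qed
  have "M.prob Bad\<^sub>1 \<le> exp (real k\<^sub>1 * p * ((1 + \<epsilon>) - 1)) / (1 + \<epsilon>) ^ T"
    unfolding Bad\<^sub>1_def prob using p \<epsilon>
    by (intro binomial_pmf_chernoff) (auto intro!: power_increasing)
  also have "\<dots> \<le> exp (real T * (\<epsilon> / (1 + \<epsilon>))) / (1 + \<epsilon>) ^ T"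
  proof -
    have "real k\<^sub>1 * p * \<epsilon> \<le> real T / (p * (1 + \<epsilon>)) * p * \<epsilon>"
      using k\<^sub>1(1) p \<epsilon> by (intro mult_right_mono) auto
    also have "\<dots> = real T * (\<epsilon> / (1 + \<epsilon>))"
      using p by simp
    finally show ?thesis
      using \<epsilon> by (intro divide_right_mono) auto
  qed
  also have "\<dots> = (exp (\<epsilon> / (1 + \<epsilon>)) / (1 + \<epsilon>)) ^ T"
    by (simp only: exp_of_nat_mult power_divide)
  finally have bad\<^sub>1: "M.prob Bad\<^sub>1 \<le> (exp (\<epsilon> / (1 + \<epsilon>)) / (1 + \<epsilon>)) ^ T" .
  have "M.prob Bad\<^sub>2 \<le> exp (real k\<^sub>2 * p * ((1 - \<epsilon>) - 1)) / (1 - \<epsilon>) ^ (T - 1)"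
    unfolding Bad\<^sub>2_def prob using p \<epsilon>
    by (intro binomial_pmf_chernoff) (auto intro!: power_decreasing)
  also have "\<dots> = exp (- (real k\<^sub>2 * p * \<epsilon>)) * (1 - \<epsilon>) / (1 - \<epsilon>) ^ T"
    using \<open>T \<noteq> 0\<close> \<epsilon> by (cases T) simp_all
  also have "\<dots> \<le> exp (real T * (- \<epsilon> / (1 - \<epsilon>))) / (1 - \<epsilon>) ^ T"
  proof -
    \<comment> \<open>The factor \<open>1 - \<epsilon> \<le> exp (- \<epsilon>)\<close>, gained from having at most \<open>T - 1\<close> successes, pays for
      rounding down the number of trials.\<close>
    have "exp (- (real k\<^sub>2 * p * \<epsilon>)) * (1 - \<epsilon>) \<le> exp (- (real k\<^sub>2 * p * \<epsilon>)) * exp (- \<epsilon>)"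
      using exp_ge_add_one_self[of "- \<epsilon>"] by (intro mult_left_mono) auto
    also have "\<dots> = exp (- ((real k\<^sub>2 * p + 1) * \<epsilon>))"
      by (simp add: algebra_simps flip: exp_add)
    also have "\<dots> \<le> exp (- (real T / (1 - \<epsilon>) * \<epsilon>))"
    proof -
      \<comment> \<open>Rounding down loses less than one trial, hence less than
        \<open>p \<le> 1\<close> expected successes.\<close>
      have "real T / (1 - \<epsilon>) = real T / (p * (1 - \<epsilon>)) * p"
        using p by simp
      also have "\<dots> \<le> (real k\<^sub>2 + 1) * p"
        using k\<^sub>2(1) p by (intro mult_right_mono) auto
      also have "\<dots> \<le> real k\<^sub>2 * p + 1"
        using p by (simp add: algebra_simps)
      finally show ?thesis
        using \<epsilon> by (simp only: exp_le_cancel_iff neg_le_iff_le) (intro mult_right_mono, auto)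
    qed
    finally show ?thesis
      using \<epsilon> by (intro divide_right_mono) auto
  qed
  also have "\<dots> = (exp (- \<epsilon> / (1 - \<epsilon>)) / (1 - \<epsilon>)) ^ T"
    by (simp only: exp_of_nat_mult power_divide)
  finally have bad\<^sub>2: "M.prob Bad\<^sub>2 \<le> (exp (- \<epsilon> / (1 - \<epsilon>)) / (1 - \<epsilon>)) ^ T" .
  have sets: "Bad\<^sub>1 \<in> sets M" "Bad\<^sub>2 \<in> sets M"
    unfolding Bad\<^sub>1_def Bad\<^sub>2_def by (rule meas)+
  have "M.prob (Bad\<^sub>1 \<union> Bad\<^sub>2) \<le> \<delta>"
    using measure_Un_le[OF sets] bad\<^sub>1 bad\<^sub>2 spec by linarith
  moreover have "{\<omega> \<in> space M. \<exists>x. mu_estimate \<Phi> \<rho> \<epsilon> \<delta> \<omega> = Some x \<and> p * W * (1 - \<epsilon>) \<le> x \<and>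
      x \<le> p * W * (1 + \<epsilon>)} = space M - (Bad\<^sub>1 \<union> Bad\<^sub>2)"
    unfolding good by auto
  moreover have "M.prob (space M - (Bad\<^sub>1 \<union> Bad\<^sub>2)) = 1 - M.prob (Bad\<^sub>1 \<union> Bad\<^sub>2)"
    using sets by (intro M.prob_compl) simp
  ultimately show ?thesis
    unfolding eps_delta_approx_def M_def[symmetric] W_def[symmetric] by simp
qed

section \<open>Accuracy and running time with uniform constants\<close>

theorem theorem2:
  "\<exists>c\<^sub>1>0. \<exists>c\<^sub>2>0. \<forall>(V :: 'v set) \<Phi> \<rho> \<epsilon> \<delta> P.
     dnf_formula V \<Phi> \<and> (\<forall>v\<in>V. 0 \<le> \<rho> v \<and> \<rho> v \<le> 1) \<and> formula_weight \<rho> \<Phi> > 0 \<and>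
     0 < \<epsilon> \<and> \<epsilon> < 3/4 \<and> 0 < \<delta> \<and> \<delta> < 3/4 \<and> set_pmf P \<subseteq> permutations_of_set \<Phi> \<longrightarrow>
     (let \<mu> = dnf_prob V \<Phi> \<rho>;
          B = ln (1 / \<delta>) / (success_prob V \<Phi> \<rho> * \<epsilon>\<^sup>2)
      in (eps_delta_approx (runs \<Phi> \<rho> P) (mu_estimate \<Phi> \<rho> \<epsilon> \<delta>) \<mu> \<epsilon> \<delta> \<and>
          ennreal (c\<^sub>1 * B) \<le> expected_trials (runs \<Phi> \<rho> P) \<epsilon> \<delta> \<and>
          expected_trials (runs \<Phi> \<rho> P) \<epsilon> \<delta> \<le> ennreal (c\<^sub>2 * B)) \<and>
         (\<forall>\<pi>\<in>permutations_of_set \<Phi>.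
          eps_delta_approx (runs_given \<Phi> \<rho> \<pi>) (mu_estimate \<Phi> \<rho> \<epsilon> \<delta>) \<mu> \<epsilon> \<delta> \<and>
          ennreal (c\<^sub>1 * B) \<le> expected_trials (runs_given \<Phi> \<rho> \<pi>) \<epsilon> \<delta> \<and>
          expected_trials (runs_given \<Phi> \<rho> \<pi>) \<epsilon> \<delta> \<le> ennreal (c\<^sub>2 * B)))"
proof (rule exI[of _ 2], intro conjI, simp, rule exI[of _ 36], intro conjI allI impI, simp)
  fix V :: "'v set" and \<Phi> \<rho> and \<epsilon> \<delta> :: real and P
  assume "dnf_formula V \<Phi> \<and> (\<forall>v\<in>V. 0 \<le> \<rho> v \<and> \<rho> v \<le> 1) \<and> formula_weight \<rho> \<Phi> > 0 \<and>
     0 < \<epsilon> \<and> \<epsilon> < 3/4 \<and> 0 < \<delta> \<and> \<delta> < 3/4 \<and> set_pmf P \<subseteq> permutations_of_set \<Phi>"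
  then have dnf: "dnf_formula V \<Phi>" "\<forall>v\<in>V. 0 \<le> \<rho> v \<and> \<rho> v \<le> 1" "formula_weight \<rho> \<Phi> > 0"
    and \<epsilon>: "0 < \<epsilon>" "\<epsilon> < 1" and \<delta>: "0 < \<delta>" "\<delta> < 3/4" "\<delta> < 2"
    and P: "set_pmf P \<subseteq> permutations_of_set \<Phi>"
    by auto
  define p where "p = success_prob V \<Phi> \<rho>"
  define M where "M = stream_space (measure_pmf (bernoulli_pmf p))"
  have p: "0 < p" "p \<le> 1"
    unfolding p_def by (rule success_prob_pos[OF dnf], rule success_prob_le_1[OF dnf])
  have approx: "eps_delta_approx M (mu_estimate \<Phi> \<rho> \<epsilon> \<delta>) (dnf_prob V \<Phi> \<rho>) \<epsilon> \<delta>"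
    unfolding dnf_prob_eq[OF dnf] M_def p_def[symmetric]
    by (rule eps_delta_approx_bernoulli[OF p \<epsilon> \<delta>(1,3) dnf(3)])
  have trials: "expected_trials M \<epsilon> \<delta> = ennreal (real (threshold \<epsilon> \<delta>) / p)"
    unfolding M_def by (rule expected_trials_bernoulli[OF p])
  \<comment> \<open>Dividing the bounds of \<open>threshold_lower\<close> and
    \<open>threshold_upper\<close> by \<open>p\<close> gives the constants 2 and 36.\<close>
  have "c * (ln (1 / \<delta>) / (p * \<epsilon>\<^sup>2)) = c * (ln (1 / \<delta>) / \<epsilon>\<^sup>2) / p" for c
    using p by (simp add: field_simps)
  then have "ennreal (2 * (ln (1 / \<delta>) / (p * \<epsilon>\<^sup>2))) \<le> expected_trials M \<epsilon> \<delta>"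
    and "expected_trials M \<epsilon> \<delta> \<le> ennreal (36 * (ln (1 / \<delta>) / (p * \<epsilon>\<^sup>2)))"
    using threshold_lower[OF \<epsilon> \<delta>(1)] threshold_upper[OF \<epsilon> \<delta>(1,2)] p
    by (simp_all only: trials) (intro ennreal_leI divide_right_mono; simp only: less_imp_le)+
  with approx show "let \<mu> = dnf_prob V \<Phi> \<rho>;
          B = ln (1 / \<delta>) / (success_prob V \<Phi> \<rho> * \<epsilon>\<^sup>2)
      in (eps_delta_approx (runs \<Phi> \<rho> P) (mu_estimate \<Phi> \<rho> \<epsilon> \<delta>) \<mu> \<epsilon> \<delta> \<and>
          ennreal (2 * B) \<le> expected_trials (runs \<Phi> \<rho> P) \<epsilon> \<delta> \<and>
          expected_trials (runs \<Phi> \<rho> P) \<epsilon> \<delta> \<le> ennreal (36 * B)) \<and>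
         (\<forall>\<pi>\<in>permutations_of_set \<Phi>.
          eps_delta_approx (runs_given \<Phi> \<rho> \<pi>) (mu_estimate \<Phi> \<rho> \<epsilon> \<delta>) \<mu> \<epsilon> \<delta> \<and>
          ennreal (2 * B) \<le> expected_trials (runs_given \<Phi> \<rho> \<pi>) \<epsilon> \<delta> \<and>
          expected_trials (runs_given \<Phi> \<rho> \<pi>) \<epsilon> \<delta> \<le> ennreal (36 * B))"
    \<comment> \<open>With a random or a fixed permutation the run has the same law
      \<open>M\<close>, so both halves of the claim are the facts about \<open>M\<close>.\<close>
    unfolding Let_def p_def[symmetric] runs_eq_bernoulli[OF dnf P] M_def
    by (intro conjI ballI) (simp_all only: runs_given_eq_bernoulli[OF dnf] p_def)
qed

end
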